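(* (a) Let $G=(V,E)$ be a connected graph with $|V|=n\ge 2$. Run the Lipschitz learning dynamics on $G$ with i.i.d. uniformly random update vertices, starting with initial profile $f_0:V\to[0,1]$. Then for every $0<\epsilon<1$, the $\epsilon$-consensus time satisfies $$\mathbb{E}[\tau_\infty(\epsilon)]\le n(\log n+1)\,(\mathrm{Diam}(G)+1)^2\,\log\frac{2}{\epsilon}.$$ (b) Conversely, there is an absolute constant $c>0$ such that for all integers $N>L\ge 2$ there are a connected graph $G=(V,E)$ with $|V|\le N$ and $\mathrm{Diam}(G)=L$, and an initial profile $f_0:V\to[0,1]$, such that for any sequence of update vertices the Lipschitz learning dynamics satisfy $$\tau_\infty(1/2)\ge c\,N\cdot\mathrm{Diam}(G)^2 .$$
   Context: All graphs are finite, undirected and simple. $\mathrm{Diam}(G)$ is the diameter in the graph distance. Given a connected graph $G=(V,E)$, an initial profile $f_0:V\to[0,1]$ and update vertices $v_1,v_2,\ldots\in V$, the Lipschitz learning dynamics are: for $t\ge 1$, $f_t(v_t)=\frac12\bigl(\max_{u\sim v_t}f_{t-1}(u)+\min_{w\sim v_t}f_{t-1}(w)\bigr)$ and $f_t(v)=f_{t-1}(v)$ for $v\ne v_t$. In the random dynamics the $v_t$ are independent and uniform on $V$. The oscillation is $\mathfrak{osc}(f)=\max_v f(v)-\min_w f(w)$, and $\tau_\infty(\epsilon)=\min\{t\ge 0:\ \mathfrak{osc}(f_t)\le\epsilon\}$. *)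

theory Defs
  imports "HOL-Probability.Probability" "Graph_Theory.Graph_Theory"
begin

text \<open>
  A finite simple undirected graph is a \<^verbatim>\<open>pair_graph\<close> of the Graph\_Theory library: finitely many
  vertices, a symmetric arc relation, no loops.  The library notion of connectedness
  is written \<^verbatim>\<open>Digraph_Component.connected\<close>, since \<^verbatim>\<open>connected\<close> alone could be read as the
  topological notion; it includes that the vertex set is nonempty.
\<close>

text \<open>The least number of edges of a walk; only meaningful if there is a walk from u to v.\<close>

definition graph_dist :: "'a pair_pre_digraph \<Rightarrow> 'a \<Rightarrow> 'a \<Rightarrow> nat" where
  "graph_dist G u v = (LEAST k. \<exists>p. pre_digraph.awalk (with_proj G) u p v \<and> length p = k)"

definition graph_diam :: "'a pair_pre_digraph \<Rightarrow> nat" where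
  "graph_diam G = Max {graph_dist G u v | u v. u \<in> pverts G \<and> v \<in> pverts G}"

definition nbrs :: "'a pair_pre_digraph \<Rightarrow> 'a \<Rightarrow> 'a set" where
  "nbrs G v = {u. (v, u) \<in> parcs G}"

text \<open>
  The step from time t to time t + 1 uses the update vertex with index t + 1; the value of the
  update sequence at index 0 is never used.
\<close>

primrec lipschitz_dyn ::
    "'a pair_pre_digraph \<Rightarrow> ('a \<Rightarrow> real) \<Rightarrow> (nat \<Rightarrow> 'a) \<Rightarrow> nat \<Rightarrow> 'a \<Rightarrow> real" where
  "lipschitz_dyn G f0 vs 0 = f0"
| "lipschitz_dyn G f0 vs (Suc t) =
     (let f = lipschitz_dyn G f0 vs t; v = vs (Suc t)
      in f(v := (Max (f ` nbrs G v) + Min (f ` nbrs G v)) / 2))"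

definition osc :: "'a pair_pre_digraph \<Rightarrow> ('a \<Rightarrow> real) \<Rightarrow> real" where
  "osc G f = Max (f ` pverts G) - Min (f ` pverts G)"

text \<open>The consensus time is infinite if the oscillation never drops to the threshold.\<close>

definition consensus_time ::
    "'a pair_pre_digraph \<Rightarrow> ('a \<Rightarrow> real) \<Rightarrow> (nat \<Rightarrow> 'a) \<Rightarrow> real \<Rightarrow> enat" where
  "consensus_time G f0 vs \<epsilon> = Inf (enat ` {t. osc G (lipschitz_dyn G f0 vs t) \<le> \<epsilon>})"

definition iid_uniform :: "'w measure \<Rightarrow> 'a set \<Rightarrow> (nat \<Rightarrow> 'w \<Rightarrow> 'a) \<Rightarrow> bool" where
  "iid_uniform P V X \<longleftrightarrow>
     prob_space.indep_vars P (\<lambda>_. count_space V) X {1..} \<and>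
     (\<forall>t\<ge>1. distr P (count_space V) (X t) = uniform_count_measure V)"

end

theory Submission
  imports Defs
begin

text \<open>
  (a) Call a stretch of updates a round if it updates every vertex.  If \<open>u\<close> is updated and
  \<open>v \<noteq> u\<close>, then \<open>\<bar>f u - f v\<bar>\<close> becomes at most the average of a bound at distance \<open>d(u,v) + 1\<close> and one
  at distance \<open>d(u,v) - 1\<close>.  Against a concave profile \<open>\<phi>\<close> of the distance, the quantity
  \<open>max \<bar>f u - f v\<bar> / \<phi>(d(u,v))\<close> contracts by \<open>\<lambda> = 1 - 1 / (2 (Diam + 1/2)\<^sup>2)\<close> once for each end of the
  pair, hence by \<open>\<lambda>\<^sup>2\<close> per round.  A round takes \<open>n H\<^sub>n\<close> uniform updates in expectation.

  (b) Take a spider with about \<open>N / L\<close> legs of length about \<open>L / 2\<close>, half of the legs starting at \<open>1\<close>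
  and half at \<open>0\<close>.  Consensus forces all legs of one kind to relax.  By monotonicity each such leg is
  compared with averaging on a path whose inner end is frozen, where the Dirichlet energy
  and the Cauchy-Schwarz inequality show that about \<open>L\<^sup>3\<close> updates on that leg are needed.
\<close>

section \<open>Graph distance\<close>

locale connected_pair_graph = pair_graph +
  assumes connected: "Digraph_Component.connected (with_proj G)"
begin

lemma ex_awalk:
  assumes "u \<in> pverts G" "v \<in> pverts G"
  shows "\<exists>p. awalk u p v"
proof -
  have "strongly_connected (with_proj G)"
    using symmetric_connected_imp_strongly_connected[OF _ connected] sym_arcs by blast
  then have "u \<rightarrow>\<^sup>*\<^bsub>with_proj G\<^esub> v"
    using assms by (auto elim!: strongly_connectedE)
  then show ?thesis
    using reachable_awalk by blast
qed

lemma graph_dist_le: "awalk u p v \<Longrightarrow> graph_dist G u v \<le> length p"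
  unfolding graph_dist_def by (rule Least_le) blast

lemma ex_shortest_awalk:
  assumes "u \<in> pverts G" "v \<in> pverts G"
  shows "\<exists>p. awalk u p v \<and> length p = graph_dist G u v"
  unfolding graph_dist_def
  using ex_awalk[OF assms] by (rule_tac LeastI_ex) blast

lemma graph_dist_self: "u \<in> pverts G \<Longrightarrow> graph_dist G u u = 0"
  using graph_dist_le[of u "[]" u] by (simp add: awalk_Nil_iff)

lemma graph_dist_commute:
  assumes "u \<in> pverts G" "v \<in> pverts G"
  shows "graph_dist G u v = graph_dist G v u"
proof -
  have len: "length (rev_path p) = length p" for p :: "('a \<times> 'a) list"
    by (induction p) auto
  have "graph_dist G v u \<le> graph_dist G u v" if uv: "u \<in> pverts G" "v \<in> pverts G" for u v
  proof -
    obtain p where "awalk u p v" "length p = graph_dist G u v"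
      using ex_shortest_awalk[OF uv] by blast
    then show ?thesis
      using graph_dist_le[of v "rev_path p" u] len by simp
  qed
  then show ?thesis
    using assms by (simp add: le_antisym)
qed

lemma graph_dist_nbr_le:
  assumes "w \<in> nbrs G u" "v \<in> pverts G"
  shows "graph_dist G w v \<le> Suc (graph_dist G u v)"
proof -
  have uw: "(u, w) \<in> parcs G" "(w, u) \<in> parcs G"
    using assms arcs_symmetric by (auto simp: nbrs_def)
  obtain p where p: "awalk u p v" "length p = graph_dist G u v"
    using ex_shortest_awalk[of u v] uw in_arcsD1 assms by blast
  then have "awalk w ((w, u) # p) v"
    using uw in_arcsD1 by (auto simp: awalk_Cons_iff)
  then show ?thesis
    using graph_dist_le[of w "(w, u) # p" v] p by simp
qed

text \<open>Follows the first arc of a shortest walk. Having such a neighbour is what makes an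
  update contract.\<close>

lemma ex_nbr_closer:
  assumes "u \<in> pverts G" "v \<in> pverts G" "u \<noteq> v"
  shows "\<exists>w\<in>nbrs G u. Suc (graph_dist G w v) \<le> graph_dist G u v"
proof -
  obtain p where p: "awalk u p v" "length p = graph_dist G u v"
    using ex_shortest_awalk assms by blast
  then obtain e q where q: "p = e # q"
    using \<open>u \<noteq> v\<close> by (cases p) (auto simp: awalk_Nil_iff)
  then have "awalk (snd e) q v" "fst e = u" "e \<in> parcs G"
    using p by (auto simp: awalk_Cons_iff)
  then show ?thesis
    using graph_dist_le[of "snd e" q v] p q by (intro bexI[of _ "snd e"]) (auto simp: nbrs_def)
qed

lemma nbrs_subset: "nbrs G u \<subseteq> pverts G"
  using in_arcsD2 by (auto simp: nbrs_def)

lemma finite_nbrs: "finite (nbrs G u)"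
  using nbrs_subset pair_finite_verts finite_subset by blast

lemma finite_dists: "finite {graph_dist G u v | u v. u \<in> pverts G \<and> v \<in> pverts G}"
proof -
  have "{graph_dist G u v | u v. u \<in> pverts G \<and> v \<in> pverts G}
      = (\<lambda>(u, v). graph_dist G u v) ` (pverts G \<times> pverts G)"
    by auto
  then show ?thesis
    using pair_finite_verts by simp
qed

lemma graph_dist_le_diam:
  assumes "u \<in> pverts G" "v \<in> pverts G"
  shows "graph_dist G u v \<le> graph_diam G"
  unfolding graph_diam_def using assms by (intro Max_ge[OF finite_dists]) blast

lemma graph_diam_eqI:
  assumes "\<And>u v. u \<in> pverts G \<Longrightarrow> v \<in> pverts G \<Longrightarrow> graph_dist G u v \<le> d"
    and "x \<in> pverts G" "y \<in> pverts G" "d \<le> graph_dist G x y"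
  shows "graph_diam G = d"
proof (rule antisym)
  show "graph_diam G \<le> d"
    unfolding graph_diam_def using assms finite_dists by (subst Max_le_iff) blast+
  show "d \<le> graph_diam G"
    using graph_dist_le_diam assms order_trans by blast
qed

end

section \<open>Contraction in one round of updates\<close>

lemma finite_image_Max_Min_obtain:
  fixes f :: "'a \<Rightarrow> real"
  assumes "finite A" "A \<noteq> {}"
  obtains a b where "a \<in> A" "b \<in> A" "Max (f ` A) = f a" "Min (f ` A) = f b"
    "\<And>w. w \<in> A \<Longrightarrow> f b \<le> f w \<and> f w \<le> f a"
proof -
  have "Max (f ` A) \<in> f ` A" "Min (f ` A) \<in> f ` A"
    using assms by auto
  moreover have "Min (f ` A) \<le> f w \<and> f w \<le> Max (f ` A)" if "w \<in> A" for w
    using assms that by auto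
  moreover from calculation(1,2) obtain a b
    where "a \<in> A" "Max (f ` A) = f a" "b \<in> A" "Min (f ` A) = f b"
    by blast
  ultimately show ?thesis
    using that[of a b] by simp
qed

text \<open>
  A concave profile, symmetric about \<open>D + 1/2\<close> so that capping distances at \<open>D\<close> costs nothing,
  with constant second difference and all relevant values within a factor \<open>2\<close> of each other.
\<close>

definition profile :: "nat \<Rightarrow> nat \<Rightarrow> real" where
  "profile D d = 2 * (real D + 1/2)^2 - (real D + 1/2 - real d)^2"

definition contraction :: "nat \<Rightarrow> real" where
  "contraction D = 1 - 1 / (2 * (real D + 1/2)^2)"

lemma profile_le: "profile D d \<le> 2 * (real D + 1/2)^2"
  by (simp add: profile_def)

lemma profile_ge: "d \<le> D \<Longrightarrow> (real D + 1/2)^2 \<le> profile D d"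
  using power_mono[of "real D + 1/2 - real d" "real D + 1/2" 2] by (simp add: profile_def)

lemma profile_nonneg: "d \<le> D \<Longrightarrow> 0 \<le> profile D d"
  using profile_ge[of d D] zero_le_power2 order_trans by blast

lemma profile_mono:
  assumes "d \<le> e" "e \<le> D"
  shows "profile D d \<le> profile D e"
proof -
  have "(real D + 1/2 - real e)^2 \<le> (real D + 1/2 - real d)^2"
    using assms by (intro power_mono) auto
  then show ?thesis
    by (simp add: profile_def)
qed

lemma contraction_bounds:
  assumes "D \<ge> 1"
  shows "0 \<le> contraction D" "contraction D \<le> 1"
proof -
  have "(1::real) \<le> (real D + 1/2)^2"
    using assms by (intro one_le_power) auto
  then show "0 \<le> contraction D" "contraction D \<le> 1"
    by (auto simp: contraction_def field_simps)
qed

text \<open>The second difference of \<open>profile\<close> is -2, so the values at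
  \<open>d + 1\<close> and \<open>d - 1\<close> average to \<open>profile D d - 1\<close>. Since
  \<open>profile\<close> never exceeds \<open>2 * (D + 1/2)^2\<close>, subtracting 1 does at least
  as much as multiplying by \<open>contraction D\<close>.\<close>

lemma profile_average:
  assumes "d' \<le> Suc d" "d' \<le> D" "Suc d'' \<le> d" "d \<le> D"
  shows "(profile D d' + profile D d'') / 2 \<le> contraction D * profile D d"
proof -
  define c where "c = 2 * (real D + 1/2)^2"
  have c: "c > 0"
    by (auto simp: c_def intro!: mult_pos_pos zero_less_power add_nonneg_pos)
  have up: "profile D d' \<le> profile D (Suc d)"
  proof (cases "Suc d \<le> D")
    case True
    then show ?thesis using assms profile_mono by blast
  next
    case False
    then have "d = D" using assms by simp
    then have "profile D (Suc d) = profile D D"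
      by (simp add: profile_def power2_eq_square algebra_simps)
    then show ?thesis using assms profile_mono by simp
  qed
  have down: "profile D d'' \<le> profile D (d - 1)"
    using assms by (intro profile_mono) auto
  have "profile D (Suc d) + profile D (d - 1) = 2 * profile D d - 2"
    using assms by (simp add: profile_def of_nat_diff power2_eq_square algebra_simps)
  moreover have "profile D d / c \<le> 1"
    using profile_le[of D d] c by (simp add: c_def)
  moreover have "contraction D * profile D d = profile D d - profile D d / c"
    by (simp add: contraction_def c_def algebra_simps)
  \<comment> \<open>Linear arithmetic over abstract reals; \<open>r\<close> stands for
    \<open>profile D d / c\<close>.\<close>
  moreover have "(x + y) / 2 \<le> z"
    if "a + b = 2 * p - 2" "r \<le> 1" "z = p - r" "x \<le> a" "y \<le> b" for x y z a b p r :: real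
    using that by simp
  ultimately show ?thesis
    using up down by blast
qed

context connected_pair_graph
begin

lemma ex_other_vertex:
  assumes "card (pverts G) \<ge> 2"
  shows "\<exists>v\<in>pverts G. v \<noteq> u"
proof (rule ccontr)
  assume "\<not> ?thesis"
  then have "card (pverts G) \<le> card {u}"
    by (intro card_mono) auto
  then show False
    using assms by simp
qed

lemma nbrs_nonempty:
  assumes "card (pverts G) \<ge> 2" "u \<in> pverts G"
  shows "nbrs G u \<noteq> {}"
proof -
  obtain v where "v \<in> pverts G" "v \<noteq> u"
    using ex_other_vertex assms by blast
  then show ?thesis
    using ex_nbr_closer assms by blast
qed

text \<open>Let \<open>w\<close> be a neighbour of \<open>x\<close> closer to \<open>v\<close>. For
  the upper bound the minimum is replaced by the larger \<open>f w\<close>, for the lower bound the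
  maximum by the smaller \<open>f w\<close>. The other extreme is at most one step further from
  \<open>v\<close> than \<open>x\<close> is, so \<open>profile_average\<close> applies both
  times.\<close>

lemma midrange_contracts:
  fixes f :: "'a \<Rightarrow> real"
  assumes x: "x \<in> pverts G" and v: "v \<in> pverts G" "x \<noteq> v" and C: "0 \<le> C"
    and bnd: "\<And>a. a \<in> nbrs G x \<Longrightarrow> \<bar>f a - f v\<bar> \<le> C * profile (graph_diam G) (graph_dist G a v)"
  shows "\<bar>(Max (f ` nbrs G x) + Min (f ` nbrs G x)) / 2 - f v\<bar>
    \<le> C * (contraction (graph_diam G) * profile (graph_diam G) (graph_dist G x v))"
proof -
  let ?D = "graph_diam G"
  let ?\<phi> = "\<lambda>a. profile ?D (graph_dist G a v)"
  obtain w where w: "w \<in> nbrs G x" "Suc (graph_dist G w v) \<le> graph_dist G x v"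
    using ex_nbr_closer assms by blast
  obtain a b where ab: "a \<in> nbrs G x" "b \<in> nbrs G x"
    and mm: "Max (f ` nbrs G x) = f a" "Min (f ` nbrs G x) = f b"
    and all: "\<And>w. w \<in> nbrs G x \<Longrightarrow> f b \<le> f w \<and> f w \<le> f a"
    using finite_image_Max_Min_obtain[OF finite_nbrs] w(1) by (metis empty_iff)
  have ord: "f b \<le> f w" "f w \<le> f a"
    using all w(1) by auto
  have avg: "(?\<phi> y + ?\<phi> w) / 2 \<le> contraction ?D * ?\<phi> x" if "y \<in> nbrs G x" for y
    using that w x v nbrs_subset[of x]
    by (intro profile_average graph_dist_nbr_le graph_dist_le_diam) auto
  have avg': "C * ?\<phi> y + C * ?\<phi> w \<le> 2 * (C * (contraction ?D * ?\<phi> x))" if "y \<in> nbrs G x" for y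
    using mult_left_mono[OF avg[OF that] C] by (simp add: algebra_simps)
  show ?thesis
    using avg'[OF ab(1)] avg'[OF ab(2)] bnd[OF ab(1)] bnd[OF ab(2)] bnd[OF w(1)] ord
    unfolding mm by (simp add: abs_le_iff field_simps)
qed

end

section \<open>Rounds of updates\<close>

text \<open>
  The state is the number of completed rounds together with the set of vertices updated in the
  current one.
\<close>

definition round_step :: "'a set \<Rightarrow> 'a \<Rightarrow> nat \<times> 'a set \<Rightarrow> nat \<times> 'a set" where
  "round_step V x s = (if V \<subseteq> insert x (snd s) then (Suc (fst s), {}) else (fst s, insert x (snd s)))"

primrec rounds :: "'a set \<Rightarrow> (nat \<Rightarrow> 'a) \<Rightarrow> nat \<Rightarrow> nat \<times> 'a set" where
  "rounds V vs 0 = (0, {})"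
| "rounds V vs (Suc t) = round_step V (vs (Suc t)) (rounds V vs t)"

context connected_pair_graph
begin

text \<open>
  A vertex updated earlier in the round already carries a factor; a second factor is gained when
  the other vertex of the pair is updated.
\<close>

lemma rounds_invariant:
  assumes card: "card (pverts G) \<ge> 2" and vs: "\<And>t. t \<ge> 1 \<Longrightarrow> vs t \<in> pverts G"
    and D: "graph_diam G \<ge> 1" and C: "0 \<le> C"
    and init: "\<And>u v. u \<in> pverts G \<Longrightarrow> v \<in> pverts G \<Longrightarrow>
      \<bar>f0 u - f0 v\<bar> \<le> C * profile (graph_diam G) (graph_dist G u v)"
    and uv: "u \<in> pverts G" "v \<in> pverts G"
  shows "\<bar>lipschitz_dyn G f0 vs t u - lipschitz_dyn G f0 vs t v\<bar>
    \<le> C * contraction (graph_diam G)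
        ^ (2 * fst (rounds (pverts G) vs t) + of_bool (u \<in> snd (rounds (pverts G) vs t))
            + of_bool (v \<in> snd (rounds (pverts G) vs t)))
      * profile (graph_diam G) (graph_dist G u v)"
  using uv
proof (induction t arbitrary: u v)
  case 0
  then show ?case using init by simp
next
  case (Suc t)
  define D where "D = graph_diam G"
  define q where "q = contraction D"
  define r where "r = fst (rounds (pverts G) vs t)"
  define S where "S = snd (rounds (pverts G) vs t)"
  define f where "f = lipschitz_dyn G f0 vs t"
  define x where "x = vs (Suc t)"
  define g where "g = f(x := (Max (f ` nbrs G x) + Min (f ` nbrs G x)) / 2)"
  have q: "0 \<le> q" "q \<le> 1"
    using contraction_bounds D by (auto simp: q_def D_def)
  have x: "x \<in> pverts G"
    using vs by (simp add: x_def)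
  have IH: "\<bar>f u - f v\<bar> \<le> C * q ^ (2 * r + of_bool (u \<in> S) + of_bool (v \<in> S))
      * profile D (graph_dist G u v)" if "u \<in> pverts G" "v \<in> pverts G" for u v
    using Suc.IH[OF that] by (simp add: f_def r_def S_def q_def D_def)
  have prof: "0 \<le> profile D (graph_dist G u v)" if "u \<in> pverts G" "v \<in> pverts G" for u v
    using that graph_dist_le_diam profile_nonneg by (simp add: D_def)
  \<comment> \<open>A factor that \<open>x\<close> or its neighbours may already carry is discarded
    and only that of \<open>v\<close> is kept. The update then supplies one factor for
    \<open>x\<close>, so the exponent is the same whether or not \<open>x\<close> lies in
    \<open>S\<close>.\<close>
  have upd: "\<bar>g x - g v\<bar> \<le> C * q ^ (2 * r + 1 + of_bool (v \<in> S)) * profile D (graph_dist G x v)"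
    if v: "v \<in> pverts G" "v \<noteq> x" for v
  proof -
    let ?C = "C * q ^ (2 * r + of_bool (v \<in> S))"
    have "\<bar>f a - f v\<bar> \<le> ?C * profile D (graph_dist G a v)" if a: "a \<in> nbrs G x" for a
    proof -
      have aV: "a \<in> pverts G" using a nbrs_subset by blast
      have "q ^ (2 * r + of_bool (a \<in> S) + of_bool (v \<in> S)) \<le> q ^ (2 * r + of_bool (v \<in> S))"
        using q by (intro power_decreasing) auto
      then have "C * q ^ (2 * r + of_bool (a \<in> S) + of_bool (v \<in> S)) * profile D (graph_dist G a v)
          \<le> ?C * profile D (graph_dist G a v)"
        using C prof[OF aV v(1)] by (intro mult_right_mono mult_left_mono) auto
      then show ?thesis using IH[OF aV v(1)] by linarith
    qed
    then have "\<bar>(Max (f ` nbrs G x) + Min (f ` nbrs G x)) / 2 - f v\<bar>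
        \<le> ?C * (q * profile D (graph_dist G x v))"
      unfolding D_def q_def using x v C q by (intro midrange_contracts) (auto simp: q_def D_def)
    then show ?thesis
      using v by (simp add: g_def algebra_simps)
  qed
  have inv: "\<bar>g u - g v\<bar> \<le> C * q ^ (2 * r + of_bool (u \<in> insert x S) + of_bool (v \<in> insert x S))
      * profile D (graph_dist G u v)" if uv: "u \<in> pverts G" "v \<in> pverts G" for u v
  proof -
    consider "u = v" | "u \<noteq> v" "u = x" | "u \<noteq> v" "v = x" | "u \<noteq> x" "v \<noteq> x" by blast
    then show ?thesis
    proof cases
      case 1
      then show ?thesis using prof[OF uv] C q by simp
    next
      case 2
      then show ?thesis using upd[of v] uv by (simp add: of_bool_def)
    next
      case 3
      then show ?thesis using upd[of u] uv graph_dist_commute[of u v]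
        by (simp add: of_bool_def abs_minus_commute)
    next
      case 4
      then show ?thesis using IH[OF uv] by (simp add: g_def)
    qed
  qed
  have g: "lipschitz_dyn G f0 vs (Suc t) = g"
    by (simp add: g_def f_def x_def Let_def)
  show ?case
  proof (cases "pverts G \<subseteq> insert x S")
    case True
    \<comment> \<open>Both ends carry a factor by now; the two together become the square credited
      to the finished round.\<close>
    then have "u \<in> insert x S" "v \<in> insert x S" using Suc.prems by auto
    then have exponent: "2 * r + of_bool (u \<in> insert x S) + of_bool (v \<in> insert x S)
        = 2 * Suc r + of_bool (u \<in> {}) + of_bool (v \<in> {})"
      by simp
    have "rounds (pverts G) vs (Suc t) = (Suc r, {})"
      using True by (simp add: round_step_def r_def S_def x_def)
    then show ?thesis
      using inv[OF Suc.prems] unfolding exponent g q_def D_def by (simp only: fst_conv snd_conv)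
  next
    case False
    then have "rounds (pverts G) vs (Suc t) = (r, insert x S)"
      by (simp add: round_step_def r_def S_def x_def)
    then show ?thesis
      using inv[OF Suc.prems] unfolding g q_def D_def by (simp only: fst_conv snd_conv)
  qed
qed

lemma osc_le:
  assumes "pverts G \<noteq> {}" "\<And>u v. u \<in> pverts G \<Longrightarrow> v \<in> pverts G \<Longrightarrow> f u - f v \<le> b"
  shows "osc G f \<le> b"
proof -
  obtain a b where "a \<in> pverts G" "b \<in> pverts G" "Max (f ` pverts G) = f a" "Min (f ` pverts G) = f b"
    by (rule finite_image_Max_Min_obtain[OF pair_finite_verts assms(1), of f]) auto
  then show ?thesis
    using assms(2) by (simp add: osc_def)
qed

lemma graph_diam_ge_1:
  assumes "card (pverts G) \<ge> 2"
  shows "graph_diam G \<ge> 1"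
proof -
  obtain u where u: "u \<in> pverts G"
    using assms by (metis card.empty ex_in_conv not_numeral_le_zero)
  obtain v where "v \<in> pverts G" "v \<noteq> u"
    using ex_other_vertex assms u by blast
  then show ?thesis
    using u ex_nbr_closer[of u v] graph_dist_le_diam[of u v] by auto
qed

text \<open>With \<open>a = (D + 1/2)^2\<close> the profile lies between \<open>a\<close> and
  \<open>2 * a\<close>. Hence \<open>C = 1 / a\<close> works initially, and returning to unweighted
  differences costs only the factor 2. The exponential comes from
  \<open>1 + x \<le> exp x\<close>.\<close>

lemma osc_after_rounds:
  assumes card: "card (pverts G) \<ge> 2" and vs: "\<And>t. t \<ge> 1 \<Longrightarrow> vs t \<in> pverts G"
    and f0: "f0 ` pverts G \<subseteq> {0..1}"
  shows "osc G (lipschitz_dyn G f0 vs t)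
    \<le> 2 * exp (- real (fst (rounds (pverts G) vs t)) / (real (graph_diam G) + 1/2)^2)"
proof -
  define D where "D = graph_diam G"
  define a where "a = (real D + 1/2)^2"
  define r where "r = fst (rounds (pverts G) vs t)"
  define q where "q = contraction D"
  have a: "a > 0"
    by (auto simp: a_def intro!: zero_less_power add_nonneg_pos)
  have D: "D \<ge> 1"
    using graph_diam_ge_1 card by (simp add: D_def)
  have q: "0 \<le> q" "q \<le> 1"
    using contraction_bounds D by (auto simp: q_def)
  have init: "\<bar>f0 u - f0 v\<bar> \<le> (1 / a) * profile (graph_diam G) (graph_dist G u v)"
    if "u \<in> pverts G" "v \<in> pverts G" for u v
  proof -
    have "f0 u \<in> {0..1}" "f0 v \<in> {0..1}" using that f0 by auto
    then have "\<bar>f0 u - f0 v\<bar> \<le> 1" by auto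
    moreover have "a \<le> profile (graph_diam G) (graph_dist G u v)"
      using profile_ge graph_dist_le_diam that by (simp add: a_def D_def)
    ultimately have "\<bar>f0 u - f0 v\<bar> * a \<le> 1 * profile (graph_diam G) (graph_dist G u v)"
      using a by (intro mult_mono) auto
    then show ?thesis using a by (simp add: field_simps)
  qed
  have *: "lipschitz_dyn G f0 vs t u - lipschitz_dyn G f0 vs t v \<le> 2 * q ^ (2 * r)"
    if uv: "u \<in> pverts G" "v \<in> pverts G" for u v
  proof -
    have p: "profile D (graph_dist G u v) \<le> 2 * a" "0 \<le> profile D (graph_dist G u v)"
      using profile_le uv graph_dist_le_diam profile_nonneg by (auto simp: a_def D_def)
    define S where "S = snd (rounds (pverts G) vs t)"
    have "lipschitz_dyn G f0 vs t u - lipschitz_dyn G f0 vs t v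
        \<le> (1 / a) * q ^ (2 * r + of_bool (u \<in> S) + of_bool (v \<in> S)) * profile D (graph_dist G u v)"
      using rounds_invariant[OF card vs _ _ init uv, where t = t] D a unfolding r_def S_def q_def D_def
      by (simp add: abs_le_iff)
    also have "\<dots> \<le> (1 / a) * q ^ (2 * r) * (2 * a)"
      using p a q by (intro mult_mono mult_left_mono power_decreasing) auto
    finally show ?thesis using a by simp
  qed
  have "pverts G \<noteq> {}"
    using card by auto
  then have "osc G (lipschitz_dyn G f0 vs t) \<le> 2 * q ^ (2 * r)"
    using osc_le * by blast
  also have "q \<le> exp (- (1 / (2 * a)))"
    using exp_ge_add_one_self[of "- (1 / (2 * a))"] by (simp add: q_def contraction_def a_def)
  then have "q ^ (2 * r) \<le> exp (- (1 / (2 * a))) ^ (2 * r)"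
    using q by (intro power_mono) auto
  also have "\<dots> = exp (- real r / a)"
    using a by (simp add: exp_of_nat_mult[symmetric])
  finally show ?thesis
    by (simp add: a_def D_def r_def)
qed

end

section \<open>Expected number of updates in the random dynamics\<close>

lemma rounds_cong:
  "(\<And>i. 1 \<le> i \<Longrightarrow> i \<le> t \<Longrightarrow> vs i = ws i) \<Longrightarrow> rounds V vs t = rounds V ws t"
  by (induction t) auto

text \<open>A complete set is emptied at once, so some vertex is always missing; this keeps the
  divisor \<open>j\<close> in \<open>remaining_step\<close> positive.\<close>

lemma rounds_subset:
  assumes "V \<noteq> {}" "\<And>i. 1 \<le> i \<Longrightarrow> i \<le> t \<Longrightarrow> vs i \<in> V"
  shows "snd (rounds V vs t) \<subset> V"
  using assms(2)
proof (induction t)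
  case 0
  then show ?case using assms(1) by auto
next
  case (Suc t)
  then have "snd (rounds V vs t) \<subset> V" "vs (Suc t) \<in> V"
    by auto
  then show ?case
    using assms(1) by (auto simp: round_step_def)
qed

text \<open>
  The coupon collector's expected number of updates until \<open>k\<close> rounds are complete: when \<open>j\<close>
  vertices are still missing from the current round, \<open>n * harm j\<close> more updates complete it.
\<close>

definition remaining :: "nat \<Rightarrow> nat \<Rightarrow> nat \<times> 'a set \<Rightarrow> real" where
  "remaining n k s = (if fst s < k
     then real n * (real (k - Suc (fst s)) * harm n + harm (n - card (snd s))) else 0)"

lemma remaining_nonneg: "0 \<le> remaining n k s"
  by (simp add: remaining_def harm_nonneg)

text \<open>Updating any of the \<open>j\<close> missing vertices lowers the value by
  \<open>n / j\<close>, and the other vertices change nothing. A uniform update thus lowers the mean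
  by exactly 1 while fewer than \<open>k\<close> rounds are complete.\<close>

lemma remaining_step:
  assumes V: "finite V" "snd s \<subset> V"
  shows "(\<Sum>x\<in>V. remaining (card V) k (round_step V x s))
    = real (card V) * (remaining (card V) k s - of_bool (fst s < k))"
proof (cases "fst s < k")
  case False
  then have "remaining (card V) k (round_step V x s) = 0" for x
    by (auto simp: remaining_def round_step_def)
  then show ?thesis
    using False by (simp add: remaining_def)
next
  case True
  define n where "n = card V"
  define r where "r = fst s"
  define S where "S = snd s"
  define j where "j = n - card S"
  define R where "R = remaining n k s"
  have S: "finite S" "S \<subset> V"
    using V finite_subset by (auto simp: S_def)
  then have j: "0 < j" "n = card S + j"
    using V psubset_card_mono[of V S] by (auto simp: j_def n_def)
  have R: "R = real n * (real (k - Suc r) * harm n + harm j)"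
    using True by (simp add: R_def remaining_def r_def S_def j_def)
  have old: "remaining n k (round_step V x s) = R" if "x \<in> S" for x
  proof -
    have "round_step V x s = s"
      using that S by (auto simp: round_step_def S_def insert_absorb)
    then show ?thesis by (simp add: R_def)
  qed
  have new: "remaining n k (round_step V x s) = R - real n / real j" if x: "x \<in> V - S" for x
  proof -
    have cins: "card (insert x S) = Suc (card S)"
      using S x by simp
    have hj: "harm j = harm (j - 1) + 1 / real j"
      using j harm_Suc[of "j - 1"] by (simp add: inverse_eq_divide)
    show ?thesis
    proof (cases "V \<subseteq> insert x S")
      case True
      then have "insert x S = V" using S x by auto
      then have "j = 1" using cins j by (simp add: n_def)
      moreover have "round_step V x s = (Suc r, {})"
        using True by (simp add: round_step_def S_def r_def)
      \<comment> \<open>When the last missing vertex is hit, the term \<open>harm n\<close> of the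
        round now starting is split off from the rounds still to come; after the final round there
        is none.\<close>
      moreover have "real (k - Suc r) * harm n = (if Suc r < k then real (k - Suc (Suc r)) * harm n + harm n else 0)"
        by (auto simp: algebra_simps of_nat_diff Suc_diff_Suc dest: Suc_leI)
      ultimately show ?thesis
        by (auto simp: R remaining_def hj harm_expand algebra_simps)
    next
      case False
      then have "round_step V x s = (r, insert x S)"
        by (simp add: round_step_def S_def r_def)
      moreover have "n - card (insert x S) = j - 1"
        using cins by (simp add: j_def)
      ultimately show ?thesis
        using \<open>fst s < k\<close> by (simp add: R remaining_def hj r_def algebra_simps)
    qed
  qed
  have "(\<Sum>x\<in>V. remaining n k (round_step V x s))
      = (\<Sum>x\<in>S. remaining n k (round_step V x s)) + (\<Sum>x\<in>V - S. remaining n k (round_step V x s))"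
    using S V sum.subset_diff[of S V] by (simp add: add.commute psubset_imp_subset)
  also have "\<dots> = real (card S) * R + real j * (R - real n / real j)"
    using old new S V by (simp add: card_Diff_subset psubset_imp_subset j_def n_def)
  also have "\<dots> = real n * (R - 1)"
    using j by (simp add: field_simps)
  finally show ?thesis
    using True by (simp add: R_def n_def)
qed

text \<open>The counting form of conditioning on the first \<open>t\<close> updates.\<close>

lemma sum_PiE_Suc:
  fixes h :: "(nat \<Rightarrow> 'a) \<Rightarrow> real"
  shows "(\<Sum>y\<in>PiE {1..Suc t} (\<lambda>_. V). h y) = (\<Sum>y\<in>PiE {1..t} (\<lambda>_. V). \<Sum>x\<in>V. h (y(Suc t := x)))"
proof -
  have "PiE {1..Suc t} (\<lambda>_. V) = (\<lambda>(x, y). y(Suc t := x)) ` (V \<times> PiE {1..t} (\<lambda>_. V))"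
    by (simp add: atLeastAtMostSuc_conv PiE_insert_eq)
  moreover have "inj_on (\<lambda>(x, y). y(Suc t := x)) (V \<times> PiE {1..t} (\<lambda>_. V))"
    by (rule inj_combinator) simp
  ultimately have "(\<Sum>y\<in>PiE {1..Suc t} (\<lambda>_. V). h y)
      = (\<Sum>(x, y)\<in>V \<times> PiE {1..t} (\<lambda>_. V). h (y(Suc t := x)))"
    by (simp add: sum.reindex case_prod_unfold comp_def)
  also have "\<dots> = (\<Sum>x\<in>V. \<Sum>y\<in>PiE {1..t} (\<lambda>_. V). h (y(Suc t := x)))"
    by (simp add: sum.cartesian_product)
  finally show ?thesis
    by (subst sum.swap) simp
qed

text \<open>Let \<open>E t\<close> be the mean of \<open>remaining\<close> over all prefixes of
  length \<open>t\<close>. By \<open>remaining_step\<close> it drops by the fraction of prefixes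
  with fewer than \<open>k\<close> rounds, so these fractions telescope to \<open>E 0 - E T\<close>,
  and \<open>E T\<close> is nonnegative.\<close>

lemma sum_incomplete_le:
  fixes V :: "'a set"
  assumes V: "finite V" "V \<noteq> {}"
  shows "(\<Sum>t<T. real (card {y \<in> PiE {1..t} (\<lambda>_. V). fst (rounds V y t) < k}) / real (card V) ^ t)
    \<le> real k * (real (card V) * harm (card V))"
proof -
  define n where "n = card V"
  have n: "n > 0" using V by (simp add: n_def card_gt_0_iff)
  define E where "E t = (\<Sum>y\<in>PiE {1..t} (\<lambda>_. V). remaining n k (rounds V y t)) / real n ^ t" for t
  define p where "p t = real (card {y \<in> PiE {1..t} (\<lambda>_. V). fst (rounds V y t) < k}) / real n ^ t" for t
  have fin: "finite (PiE {1..t} (\<lambda>_. V))" for t :: nat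
    using V by (simp add: finite_PiE)
  have step: "E (Suc t) = E t - p t" for t
  proof -
    have "(\<Sum>x\<in>V. remaining n k (rounds V (y(Suc t := x)) (Suc t)))
        = real n * (remaining n k (rounds V y t) - of_bool (fst (rounds V y t) < k))"
      if "y \<in> PiE {1..t} (\<lambda>_. V)" for y
    proof -
      have "rounds V (y(Suc t := x)) (Suc t) = round_step V x (rounds V y t)" for x
        using rounds_cong[of t "y(Suc t := x)" y V] by simp
      moreover have "snd (rounds V y t) \<subset> V"
        using that V by (intro rounds_subset) auto
      ultimately show ?thesis
        using remaining_step[OF V(1), of "rounds V y t" k] by (simp add: n_def)
    qed
    then have "(\<Sum>y\<in>PiE {1..Suc t} (\<lambda>_. V). remaining n k (rounds V y (Suc t)))
        = (\<Sum>y\<in>PiE {1..t} (\<lambda>_. V). real n * (remaining n k (rounds V y t) - of_bool (fst (rounds V y t) < k)))"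
      unfolding sum_PiE_Suc by (rule sum.cong[OF refl])
    also have "\<dots> = real n * ((\<Sum>y\<in>PiE {1..t} (\<lambda>_. V). remaining n k (rounds V y t))
        - real (card {y \<in> PiE {1..t} (\<lambda>_. V). fst (rounds V y t) < k}))"
      using fin[of t] by (simp add: sum_distrib_left[symmetric] sum_subtractf sum_of_bool_eq Int_def)
    finally show ?thesis
      using n by (simp add: E_def p_def diff_divide_distrib)
  qed
  have sum_p: "(\<Sum>t<T. p t) = E 0 - E T"
    by (induction T) (auto simp: step)
  moreover have "0 \<le> E T"
    by (simp add: E_def sum_nonneg remaining_nonneg)
  moreover have "E 0 = real k * (real n * harm n)"
    by (cases k) (auto simp: E_def remaining_def algebra_simps)
  ultimately show ?thesis
    by (simp add: p_def n_def)
qed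

text \<open>Independence gives every single prefix the probability \<open>1 / card V ^ t\<close>,
  and \<open>B\<close> is a finite disjoint union of single prefixes.\<close>

lemma prob_prefix:
  assumes P: "prob_space P" and iid: "iid_uniform P V X" and V: "finite V" "V \<noteq> {}"
    and B: "B \<subseteq> PiE {1..t} (\<lambda>_. V)"
  shows "{\<omega> \<in> space P. restrict (\<lambda>i. X i \<omega>) {1..t} \<in> B} \<in> sets P"
    and "measure P {\<omega> \<in> space P. restrict (\<lambda>i. X i \<omega>) {1..t} \<in> B} = real (card B) / real (card V) ^ t"
proof -
  interpret prob_space P by fact
  have rv: "X i \<in> measurable P (count_space V)" if "i \<ge> 1" for i
    using iid that by (auto simp: iid_uniform_def indep_vars_def)
  have ind: "indep_vars (\<lambda>_. count_space V) X {1..}"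
    using iid by (simp add: iid_uniform_def)
  have single: "prob (X i -` {v} \<inter> space P) = 1 / real (card V)" if "i \<ge> 1" "v \<in> V" for i v
  proof -
    have "prob (X i -` {v} \<inter> space P) = measure (distr P (count_space V) (X i)) {v}"
      using rv that by (subst measure_distr) auto
    also have "\<dots> = 1 / real (card V)"
      using iid that V by (simp add: iid_uniform_def measure_uniform_count_measure)
    finally show ?thesis .
  qed
  define A where "A y = {\<omega> \<in> space P. restrict (\<lambda>i. X i \<omega>) {1..t} = y}" for y
  have A: "A y \<in> sets P \<and> prob (A y) = 1 / real (card V) ^ t" if y: "y \<in> PiE {1..t} (\<lambda>_. V)" for y
  proof (cases "t = 0")
    \<comment> \<open>The empty prefix is separate because an empty intersection is
      \<open>UNIV\<close> and not \<open>space P\<close>.\<close>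
    case True
    then have "A y = space P" using y by (auto simp: A_def)
    then show ?thesis using True by (simp add: prob_space)
  next
    case False
    have "A y = (\<Inter>i\<in>{1..t}. X i -` {y i} \<inter> space P)"
      using y False by (auto simp: A_def restrict_def fun_eq_iff PiE_def extensional_def)
    moreover have yV: "y i \<in> V" if "i \<in> {1..t}" for i
      using y that by auto
    moreover have "(\<Inter>i\<in>{1..t}. X i -` {y i} \<inter> space P) \<in> sets P"
      using False rv yV by (intro sets.finite_INT measurable_sets[OF rv]) auto
    moreover have "prob (\<Inter>i\<in>{1..t}. X i -` {y i} \<inter> space P) = (\<Prod>i\<in>{1..t}. prob (X i -` {y i} \<inter> space P))"
      using False yV by (intro indep_varsD[OF ind]) auto
    moreover have "(\<Prod>i\<in>{1..t}. prob (X i -` {y i} \<inter> space P)) = (\<Prod>i\<in>{1..t}. 1 / real (card V))"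
      using yV by (intro prod.cong refl single) auto
    ultimately show ?thesis
      by (simp add: power_one_over)
  qed
  have fin: "finite B"
    using B V finite_subset by (metis finite_PiE finite_atLeastAtMost)
  have un: "{\<omega> \<in> space P. restrict (\<lambda>i. X i \<omega>) {1..t} \<in> B} = (\<Union>y\<in>B. A y)"
    by (auto simp: A_def)
  show "{\<omega> \<in> space P. restrict (\<lambda>i. X i \<omega>) {1..t} \<in> B} \<in> sets P"
    unfolding un using A B fin by (intro sets.finite_UN) auto
  have "prob (\<Union>y\<in>B. A y) = (\<Sum>y\<in>B. prob (A y))"
    using A B fin by (intro finite_measure_finite_Union) (auto simp: disjoint_family_on_def A_def)
  also have "\<dots> = (\<Sum>y\<in>B. 1 / real (card V) ^ t)"
    using A B by (intro sum.cong) auto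
  finally show "prob {\<omega> \<in> space P. restrict (\<lambda>i. X i \<omega>) {1..t} \<in> B} = real (card B) / real (card V) ^ t"
    unfolding un by simp
qed

section \<open>Expectation as a sum of tail probabilities\<close>

lemma ennreal_of_enat_eq_suminf:
  "ennreal_of_enat \<tau> = (\<Sum>t. if enat t < \<tau> then 1 else 0)"
proof -
  have "(\<lambda>t::nat. if enat t < \<tau> then 1 else 0) sums ennreal_of_enat \<tau>"
    using sums_If_finite[of "\<lambda>t. enat t < \<tau>" "\<lambda>_. 1 :: ennreal"]
    by (cases \<tau>) (simp_all add: sums_def of_nat_tendsto_top_ennreal)
  then show ?thesis
    by (simp add: sums_iff)
qed

text \<open>The event that \<open>\<tau>\<close> exceeds \<open>t\<close> is contained in the
  measurable \<open>A t\<close>, so the tail sum of \<open>\<tau>\<close> is dominated by the sum of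
  their indicators; the bound on partial sums passes to the series.\<close>

lemma nn_integral_enat_le:
  fixes \<tau> :: "'w \<Rightarrow> enat"
  assumes sets: "\<And>t. A t \<in> sets P"
    and \<tau>: "\<And>\<omega> t. \<omega> \<in> space P \<Longrightarrow> \<omega> \<notin> A t \<Longrightarrow> \<tau> \<omega> \<le> enat t"
    and sum: "\<And>T. (\<Sum>t<T. measure P (A t)) \<le> b"
    and "finite_measure P"
  shows "(\<integral>\<^sup>+ \<omega>. ennreal_of_enat (\<tau> \<omega>) \<partial>P) \<le> ennreal b"
proof -
  interpret finite_measure P by fact
  have "(\<integral>\<^sup>+ \<omega>. ennreal_of_enat (\<tau> \<omega>) \<partial>P) \<le> (\<integral>\<^sup>+ \<omega>. (\<Sum>t. indicator (A t) \<omega>) \<partial>P)"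
  proof (intro nn_integral_mono)
    fix \<omega> assume "\<omega> \<in> space P"
    then show "ennreal_of_enat (\<tau> \<omega>) \<le> (\<Sum>t. indicator (A t) \<omega>)"
      unfolding ennreal_of_enat_eq_suminf using \<tau>
      by (intro suminf_le) (auto simp: indicator_def not_le[symmetric])
  qed
  also have "\<dots> = (\<Sum>t. emeasure P (A t))"
    using sets by (subst nn_integral_suminf) auto
  also have "\<dots> \<le> ennreal b"
  proof -
    have "(\<Sum>t<T. emeasure P (A t)) \<le> ennreal b" for T
      using sum[of T] by (simp add: emeasure_eq_measure sum_ennreal ennreal_leI)
    then show ?thesis
      by (simp add: suminf_eq_SUP SUP_least)
  qed
  finally show ?thesis .
qed

text \<open>The difference of \<open>harm n\<close> and \<open>ln n\<close> decreases in
  \<open>n\<close> and equals 1 at \<open>n = 1\<close>; the library sequence is shifted by one,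
  hence \<open>n - 1\<close>.\<close>

lemma harm_le_ln:
  assumes "n > 0"
  shows "harm n \<le> ln (real n) + 1"
  using decseqD[OF decseq_harm_diff_ln, of 0 "n - 1"] assms by (simp add: harm_expand)

context connected_pair_graph
begin

lemma expected_consensus_time:
  assumes card: "card (pverts G) \<ge> 2" and f0: "f0 ` pverts G \<subseteq> {0..1}"
    and P: "prob_space P" and iid: "iid_uniform P (pverts G) X"
    and \<epsilon>: "0 < \<epsilon>" "\<epsilon> < 1"
  shows "(\<integral>\<^sup>+ \<omega>. ennreal_of_enat (consensus_time G f0 (\<lambda>t. X t \<omega>) \<epsilon>) \<partial>P)
    \<le> ennreal (real (card (pverts G)) * (ln (real (card (pverts G))) + 1)
        * (real (graph_diam G) + 1)^2 * ln (2 / \<epsilon>))"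
proof -
  interpret prob_space P by fact
  define V where "V = pverts G"
  define n where "n = card V"
  define D where "D = graph_diam G"
  \<comment> \<open>Chosen so that \<open>2 * exp (- K / (D + 1/2)^2) = \<epsilon>\<close>;
    \<open>k\<close> is the number of rounds that suffices.\<close>
  define K where "K = (real D + 1/2)^2 * ln (2 / \<epsilon>)"
  define k where "k = nat \<lceil>K\<rceil>"
  define A where "A t = {\<omega> \<in> space P. fst (rounds V (\<lambda>t. X t \<omega>) t) < k}" for t
  define B where "B t = {y \<in> PiE {1..t} (\<lambda>_. V). fst (rounds V y t) < k}" for t
  have V: "finite V" "V \<noteq> {}"
    using pair_finite_verts card by (auto simp: V_def)
  have D: "D \<ge> 1"
    using graph_diam_ge_1 card by (simp add: D_def)
  have ln2: "ln (2 / \<epsilon>) \<ge> 2/3"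
  proof -
    have "ln (2::real) \<ge> 2/3" by (rule ln2_ge_two_thirds)
    moreover have "ln \<epsilon> \<le> 0" using \<epsilon> by simp
    moreover have "ln (2 / \<epsilon>) = ln 2 - ln \<epsilon>" using \<epsilon> by (simp add: ln_div)
    ultimately show ?thesis by linarith
  qed
  have XV: "X t \<omega> \<in> V" if "t \<ge> 1" "\<omega> \<in> space P" for t \<omega>
    using iid that measurable_space[of "X t" P "count_space V" \<omega>]
    by (auto simp: iid_uniform_def indep_vars_def V_def)
  have prefix: "A t = {\<omega> \<in> space P. restrict (\<lambda>i. X i \<omega>) {1..t} \<in> B t}" for t
  proof -
    have "rounds V (\<lambda>i. X i \<omega>) t = rounds V (restrict (\<lambda>i. X i \<omega>) {1..t}) t" for \<omega>
      by (rule rounds_cong) auto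
    then show ?thesis
      using XV by (auto simp: A_def B_def)
  qed
  have prob: "A t \<in> sets P" "measure P (A t) = real (card (B t)) / real n ^ t" for t
    using prob_prefix[OF P iid[folded V_def] V, of "B t" t] unfolding prefix n_def B_def by auto
  have small: "consensus_time G f0 (\<lambda>t. X t \<omega>) \<epsilon> \<le> enat t" if \<omega>: "\<omega> \<in> space P" "\<omega> \<notin> A t" for \<omega> t
  proof -
    define r where "r = fst (rounds V (\<lambda>t. X t \<omega>) t)"
    define a where "a = (real D + 1/2)^2"
    have a: "a > 0"
      by (auto simp: a_def intro!: zero_less_power add_nonneg_pos)
    have "k \<le> r" using \<omega> by (simp add: A_def r_def)
    then have "K \<le> real r"
      unfolding k_def by linarith
    then have "ln (2 / \<epsilon>) \<le> real r / a"
      using a by (simp add: K_def a_def field_simps)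
    then have "2 * exp (- real r / a) \<le> 2 * exp (- ln (2 / \<epsilon>))"
      by simp
    also have "\<dots> = \<epsilon>"
      using \<epsilon> by (simp add: exp_minus)
    finally have "osc G (lipschitz_dyn G f0 (\<lambda>t. X t \<omega>) t) \<le> \<epsilon>"
      using osc_after_rounds[OF card _ f0, of "\<lambda>t. X t \<omega>" t] XV \<omega>
      by (simp add: V_def r_def a_def D_def)
    then show ?thesis
      unfolding consensus_time_def by (intro Inf_lower) auto
  qed
  have "(\<integral>\<^sup>+ \<omega>. ennreal_of_enat (consensus_time G f0 (\<lambda>t. X t \<omega>) \<epsilon>) \<partial>P)
      \<le> ennreal (real k * (real n * harm n))"
  proof (rule nn_integral_enat_le)
    show "(\<Sum>t<T. measure P (A t)) \<le> real k * (real n * harm n)" for T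
      using sum_incomplete_le[OF V, of k T] unfolding prob n_def B_def .
    show "finite_measure P" by (rule finite_measure_axioms)
  qed (use prob small in auto)
  also have "real k * (real n * harm n) \<le> ((real D + 1)^2 * ln (2 / \<epsilon>)) * (real n * (ln (real n) + 1))"
  proof (intro mult_mono mult_left_mono)
    have "K \<ge> 0"
      unfolding K_def using ln2 by (intro mult_nonneg_nonneg) auto
    then have "real k \<le> K + 1"
      unfolding k_def by linarith
    \<comment> \<open>Rounding \<open>K\<close> up costs at most 1. Replacing \<open>D + 1/2\<close>
      by \<open>D + 1\<close> gains \<open>D + 3/4\<close> in the square, which is at least
      \<open>3/2\<close>, while \<open>ln (2 / \<epsilon>)\<close> is at least
      \<open>2/3\<close>.\<close>
    also have "1 \<le> (real D + 3/4) * ln (2 / \<epsilon>)"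
      using mult_mono[of "3/2" "real D + 3/4" "2/3" "ln (2 / \<epsilon>)"] D ln2 by simp
    then have "K + 1 \<le> (real D + 1)^2 * ln (2 / \<epsilon>)"
      by (simp add: K_def power2_eq_square algebra_simps)
    finally show "real k \<le> (real D + 1)^2 * ln (2 / \<epsilon>)" .
    show "harm n \<le> ln (real n) + 1"
      using V by (intro harm_le_ln) (simp add: n_def card_gt_0_iff)
  qed (use ln2 in \<open>auto simp: harm_nonneg\<close>)
  finally show ?thesis
    by (simp add: n_def V_def D_def mult_ac ennreal_leI)
qed

end

section \<open>Averaging on a path with one end fixed\<close>

definition path_step :: "nat \<Rightarrow> (nat \<Rightarrow> real) \<Rightarrow> nat \<Rightarrow> nat \<Rightarrow> real" where
  "path_step K h i = (if 1 \<le> i \<and> i \<le> K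
     then h(i := if i = K then h (K - 1) else (h (i - 1) + h (i + 1)) / 2) else h)"

text \<open>The start is linear, although real legs start constant off the centre: a jump from 0 to
  1 would have energy 1, whereas the linear profile below it has energy only
  \<open>1 / K\<close>.\<close>

primrec path_dyn :: "nat \<Rightarrow> (nat \<Rightarrow> nat) \<Rightarrow> nat \<Rightarrow> nat \<Rightarrow> real" where
  "path_dyn K p 0 = (\<lambda>i. real i / real K)"
| "path_dyn K p (Suc t) = path_step K (path_dyn K p t) (p (Suc t))"

definition energy :: "nat \<Rightarrow> (nat \<Rightarrow> real) \<Rightarrow> real" where
  "energy K h = (\<Sum>j<K. (h (Suc j) - h j)^2)"

text \<open>Moving an interior point by \<open>\<Delta>\<close> to the midpoint of its neighbours
  lowers the energy of its two edges by \<open>2 * \<Delta>^2\<close>; moving the tip lowers it by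
  \<open>\<Delta>^2\<close>.\<close>

lemma energy_step:
  assumes "1 \<le> i" "i \<le> K"
  shows "(path_step K h i i - h i)^2 \<le> energy K h - energy K (path_step K h i)"
proof -
  obtain m where m: "i = Suc m" using assms by (cases i) auto
  define h' where "h' = path_step K h i"
  have other: "h' j = h j" if "j \<noteq> i" for j
    using that by (simp add: h'_def path_step_def)
  show ?thesis
  proof (cases "i = K")
    case True
    then have K: "K = Suc m" using m by simp
    have en: "energy K g = (\<Sum>j<m. (g (Suc j) - g j)^2) + (g (Suc m) - g m)^2" for g
      by (simp add: energy_def K)
    have eq: "(\<Sum>j<m. (h' (Suc j) - h' j)^2) = (\<Sum>j<m. (h (Suc j) - h j)^2)"
      using m by (intro sum.cong) (auto simp: other)
    have vals: "h' (Suc m) = h m" "h' m = h m"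
      using K m by (auto simp: h'_def path_step_def)
    show ?thesis
      unfolding h'_def[symmetric] unfolding en eq m by (simp add: vals power2_commute)
  next
    case False
    define R where "R = {..<K} - {m, Suc m}"
    have split: "{..<K} = insert m (insert (Suc m) R)" "finite R" "m \<notin> insert (Suc m) R" "Suc m \<notin> R"
      using assms m False by (auto simp: R_def)
    have en: "energy K g = (g (Suc m) - g m)^2 + ((g (Suc (Suc m)) - g (Suc m))^2
        + (\<Sum>j\<in>R. (g (Suc j) - g j)^2))" for g
      unfolding energy_def split(1) using split(2-4) by simp
    have eq: "(\<Sum>j\<in>R. (h' (Suc j) - h' j)^2) = (\<Sum>j\<in>R. (h (Suc j) - h j)^2)"
      using m by (intro sum.cong) (auto simp: other R_def)
    have vals: "h' (Suc m) = (h m + h (Suc (Suc m))) / 2" "h' m = h m" "h' (Suc (Suc m)) = h (Suc (Suc m))"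
      using False assms m by (auto simp: h'_def path_step_def)
    have "((x + z) / 2 - y)^2 \<le> (y - x)^2 + (z - y)^2 - (((x + z) / 2 - x)^2 + (z - (x + z) / 2)^2)"
      for x y z :: real
    proof -
      have "(y - x)^2 + (z - y)^2 - (((x + z) / 2 - x)^2 + (z - (x + z) / 2)^2) = 2 * ((x + z) / 2 - y)^2"
        by (simp add: power2_eq_square field_simps)
      then show ?thesis by simp
    qed
    from this[of "h m" "h (Suc (Suc m))" "h (Suc m)"] show ?thesis
      unfolding h'_def[symmetric] en eq using m by (simp add: vals)
  qed
qed

lemma path_dyn_0: "path_dyn K p t 0 = 0"
  by (induction t) (auto simp: path_step_def)

text \<open>A new value lies between the old values of its neighbours, so the order along the path
  survives. Hence a low tip forces the whole path to be low.\<close>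

lemma path_dyn_mono:
  assumes "j < K"
  shows "path_dyn K p t j \<le> path_dyn K p t (Suc j)"
  using assms
proof (induction t arbitrary: j)
  case 0
  then show ?case by (simp add: divide_right_mono)
next
  case (Suc t)
  define i where "i = p (Suc t)"
  define h where "h = path_dyn K p t"
  have h: "h j \<le> h (Suc j)" if "j < K" for j
    using Suc.IH that by (simp add: h_def)
  consider "\<not> (1 \<le> i \<and> i \<le> K)" | "1 \<le> i" "i = K" | "1 \<le> i" "i < K" by linarith
  then have "path_step K h i j \<le> path_step K h i (Suc j)"
  proof cases
    case 1
    then show ?thesis using h Suc.prems by (auto simp: path_step_def)
  next
    case 2
    then show ?thesis using h Suc.prems by (auto simp: path_step_def)
  next
    case 3
    have "h (i - 1) \<le> h i" "h i \<le> h (i + 1)"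
      using h[of "i - 1"] h[of i] 3 by auto
    then have "h (i - Suc 0) \<le> h (Suc i)" by simp
    moreover have "h j \<le> h (Suc (Suc j))" if "Suc j < K"
      using h[of j] h[of "Suc j"] that by simp
    ultimately show ?thesis using 3 h Suc.prems by (auto simp: path_step_def)
  qed
  then show ?case by (simp add: h_def i_def)
qed

lemma path_dyn_le_end:
  assumes "i \<le> K"
  shows "path_dyn K p t i \<le> path_dyn K p t K"
  using assms by (induction rule: inc_induct) (auto intro: order_trans path_dyn_mono)

text \<open>Cauchy-Schwarz in linearised form: a displacement \<open>\<Delta>\<close> lowers the sum
  by at most \<open>\<Delta> \<le> \<eta> * \<Delta>^2 + 1 / (4 * \<eta>)\<close>, and the quadratic
  term is paid by the drop in energy. The weight \<open>\<eta>\<close> is left free for later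
  optimisation.\<close>

lemma path_potential:
  assumes \<eta>: "\<eta> > 0" and I: "finite I"
  shows "(\<Sum>i\<in>I. path_dyn K p 0 i) - \<eta> * energy K (path_dyn K p 0)
      - real (card {s \<in> {1..t}. 1 \<le> p s \<and> p s \<le> K}) / (4 * \<eta>)
    \<le> (\<Sum>i\<in>I. path_dyn K p t i) - \<eta> * energy K (path_dyn K p t)"
proof (induction t)
  case 0
  then show ?case by simp
next
  case (Suc t)
  define i where "i = p (Suc t)"
  define h where "h = path_dyn K p t"
  define h' where "h' = path_step K h i"
  define c where "c t = card {s \<in> {1..t}. 1 \<le> p s \<and> p s \<le> K}" for t
  have h': "path_dyn K p (Suc t) = h'"
    by (simp add: h'_def h_def i_def)
  show ?case
  proof (cases "1 \<le> i \<and> i \<le> K")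
    case False
    then have "h' = h"
      by (auto simp: h'_def path_step_def)
    moreover have "{s \<in> {1..Suc t}. 1 \<le> p s \<and> p s \<le> K} = {s \<in> {1..t}. 1 \<le> p s \<and> p s \<le> K}"
      using False by (auto simp: i_def le_Suc_eq)
    ultimately show ?thesis
      unfolding h' using Suc by (simp add: h_def)
  next
    case True
    have "{s \<in> {1..Suc t}. 1 \<le> p s \<and> p s \<le> K} = insert (Suc t) {s \<in> {1..t}. 1 \<le> p s \<and> p s \<le> K}"
      using True by (auto simp: i_def le_Suc_eq)
    then have c: "c (Suc t) = Suc (c t)"
      by (simp add: c_def)
    define \<Delta> where "\<Delta> = \<bar>h' i - h i\<bar>"
    have "(\<Sum>j\<in>I. h j) - (\<Sum>j\<in>I. h' j) \<le> \<Delta>"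
    proof -
      have "(\<Sum>j\<in>I. h j) - (\<Sum>j\<in>I. h' j) = (\<Sum>j\<in>I. if j = i then h i - h' i else 0)"
        unfolding sum_subtractf[symmetric]
        by (intro sum.cong) (auto simp: h'_def path_step_def)
      also have "\<dots> \<le> \<Delta>"
        using I by (auto simp: \<Delta>_def)
      finally show ?thesis .
    qed
    moreover have "\<Delta> \<le> \<eta> * \<Delta>^2 + 1 / (4 * \<eta>)"
    proof -
      have "0 \<le> (2 * \<eta> * \<Delta> - 1)^2 / (4 * \<eta>)"
        using \<eta> by simp
      also have "\<dots> = \<eta> * \<Delta>^2 + 1 / (4 * \<eta>) - \<Delta>"
        using \<eta> by (simp add: power2_eq_square field_simps)
      finally show ?thesis by simp
    qed
    moreover have "\<eta> * \<Delta>^2 \<le> \<eta> * (energy K h - energy K h')"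
      using energy_step[of i K h] True \<eta> by (intro mult_left_mono) (auto simp: \<Delta>_def h'_def)
    moreover have "real (c (Suc t)) / (4 * \<eta>) = real (c t) / (4 * \<eta>) + 1 / (4 * \<eta>)"
      by (simp add: c add_divide_distrib)
    ultimately show ?thesis
      using Suc unfolding h' c_def[symmetric] h_def[symmetric] by (simp add: algebra_simps)
  qed
qed

text \<open>
  Lowering the end to \<open>3/4\<close> needs total displacement of order \<open>K\<close>, whereas the squared
  displacements sum to at most the initial energy \<open>1/K\<close>; by Cauchy-Schwarz this takes
  about \<open>K^3\<close> updates.
\<close>

lemma path_dyn_lower_bound:
  assumes K: "K \<ge> 1" and low: "path_dyn K p t K \<le> 3/4"
  shows "real K ^ 3 / 4096 \<le> real (card {s \<in> {1..t}. 1 \<le> p s \<and> p s \<le> K})"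
proof -
  \<comment> \<open>On the outer eighth of the path the values start at \<open>7/8\<close> or more
    and end at \<open>3/4\<close> or less, so their sum falls by at least
    \<open>K / 64\<close>.\<close>
  define I where "I = {K - K div 8..K}"
  \<comment> \<open>The initial energy \<open>1 / K\<close> then accounts for
    \<open>K / 128\<close>, half of that fall; the other half needs
    \<open>K / 128 * (4 * \<eta>) = K^3 / 4096\<close> updates.\<close>
  define \<eta> where "\<eta> = real K ^ 2 / 128"
  define c where "c = real (card {s \<in> {1..t}. 1 \<le> p s \<and> p s \<le> K})"
  have \<eta>: "\<eta> > 0" using K by (simp add: \<eta>_def)
  have "real K / 8 \<le> real (card I)"
  proof -
    have "card I = Suc (K div 8)" by (simp add: I_def Suc_diff_le)
    then show ?thesis by linarith
  qed
  moreover have "real (card I) * (1/8) \<le> (\<Sum>i\<in>I. path_dyn K p 0 i) - (\<Sum>i\<in>I. path_dyn K p t i)"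
  proof -
    have "1/8 \<le> path_dyn K p 0 i - path_dyn K p t i" if i: "i \<in> I" for i
    proof -
      have "7 * real K \<le> 8 * real i"
        using i by (auto simp: I_def)
      then have "7/8 \<le> path_dyn K p 0 i"
        using K by (simp add: field_simps)
      moreover have "path_dyn K p t i \<le> 3/4"
        using path_dyn_le_end[of i K p t] i low by (auto simp: I_def)
      ultimately show ?thesis by linarith
    qed
    then show ?thesis
      unfolding sum_subtractf[symmetric] by (intro sum_bounded_below) auto
  qed
  moreover have "energy K (path_dyn K p 0) = 1 / real K"
    using K by (simp add: energy_def diff_divide_distrib[symmetric] power2_eq_square)
  moreover have "0 \<le> \<eta> * energy K (path_dyn K p t)"
    using \<eta> by (simp add: energy_def sum_nonneg)
  ultimately have "real K / 64 \<le> \<eta> * (1 / real K) + c / (4 * \<eta>)"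
    using path_potential[OF \<eta>, of I K p t] by (simp add: I_def c_def)
  also have "\<eta> * (1 / real K) = real K / 128"
    using K by (simp add: \<eta>_def power2_eq_square)
  finally have "real K / 128 * (4 * \<eta>) \<le> c"
    using \<eta> by (simp add: field_simps)
  then show ?thesis
    by (simp add: \<eta>_def c_def power2_eq_square power3_eq_cube)
qed

lemma path_dyn_le:
  assumes init: "\<And>i. i \<le> K \<Longrightarrow> real i / real K \<le> F 0 i"
    and base: "\<And>t. 0 \<le> F t 0"
    and upd: "\<And>t i. 1 \<le> i \<Longrightarrow> i \<le> K \<Longrightarrow> p (Suc t) = i \<Longrightarrow>
      F (Suc t) i = (if i = K then F t (K - 1) else (F t (i - 1) + F t (i + 1)) / 2)"
    and keep: "\<And>t i. 1 \<le> i \<Longrightarrow> i \<le> K \<Longrightarrow> p (Suc t) \<noteq> i \<Longrightarrow> F (Suc t) i = F t i"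
    and i: "i \<le> K"
  shows "path_dyn K p t i \<le> F t i"
  using i
proof (induction t arbitrary: i)
  case 0
  then show ?case using init by simp
next
  case (Suc t)
  show ?case
  proof (cases "i = 0")
    case True
    then show ?thesis using path_dyn_0[of K p "Suc t"] base[of "Suc t"] by simp
  next
    case False
    then have i: "1 \<le> i" "i \<le> K" using Suc.prems by auto
    show ?thesis
    proof (cases "p (Suc t) = i")
      case True
      have "path_dyn K p t (K - 1) \<le> F t (K - 1)"
        using Suc.IH by simp
      moreover have "path_dyn K p t (i - 1) \<le> F t (i - 1)"
        using Suc.IH i by simp
      moreover have "path_dyn K p t (i + 1) \<le> F t (i + 1)" if "i \<noteq> K"
        using Suc.IH i that by simp
      ultimately show ?thesis
        using upd[OF i True] True i by (auto simp: path_step_def)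
    next
      case False
      then show ?thesis
        using keep[OF i False] Suc.IH[OF i(2)] by (simp add: path_step_def)
    qed
  qed
qed

section \<open>Distance lower bounds by potentials, and the range of the dynamics\<close>

context connected_pair_graph
begin

lemma awalk_potential:
  fixes g :: "'a \<Rightarrow> int"
  assumes "\<And>x y. (x, y) \<in> parcs G \<Longrightarrow> \<bar>g x - g y\<bar> \<le> 1" and "awalk u p v"
  shows "\<bar>g u - g v\<bar> \<le> int (length p)"
  using assms(2)
proof (induction p arbitrary: u)
  case Nil
  then show ?case by (simp add: awalk_Nil_iff)
next
  case (Cons e p)
  then have e: "e \<in> parcs G" "fst e = u" "awalk (snd e) p v"
    by (auto simp: awalk_Cons_iff)
  then have "\<bar>g u - g (snd e)\<bar> \<le> 1"
    using assms(1)[of u "snd e"] by auto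
  then show ?case
    using Cons.IH[OF e(3)] by simp
qed

lemma potential_le_graph_dist:
  fixes g :: "'a \<Rightarrow> int"
  assumes "\<And>x y. (x, y) \<in> parcs G \<Longrightarrow> \<bar>g x - g y\<bar> \<le> 1"
    and "u \<in> pverts G" "v \<in> pverts G"
  shows "\<bar>g u - g v\<bar> \<le> int (graph_dist G u v)"
proof -
  obtain p where "awalk u p v" "length p = graph_dist G u v"
    using ex_shortest_awalk[OF assms(2,3)] by blast
  then show ?thesis
    using awalk_potential[of g u p v] assms(1) by simp
qed

lemma lipschitz_dyn_bounds:
  assumes card: "card (pverts G) \<ge> 2" and f0: "f0 ` pverts G \<subseteq> {0..1}"
    and vs: "\<And>t. t \<ge> 1 \<Longrightarrow> vs t \<in> pverts G" and "v \<in> pverts G"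
  shows "0 \<le> lipschitz_dyn G f0 vs t v \<and> lipschitz_dyn G f0 vs t v \<le> 1"
  using assms(4)
proof (induction t arbitrary: v)
  case 0
  then show ?case using f0 by auto
next
  case (Suc t)
  define f where "f = lipschitz_dyn G f0 vs t"
  define x where "x = vs (Suc t)"
  have "nbrs G x \<noteq> {}"
    using nbrs_nonempty card vs by (simp add: x_def)
  then obtain a b where "a \<in> nbrs G x" "b \<in> nbrs G x"
    and mm: "Max (f ` nbrs G x) = f a" "Min (f ` nbrs G x) = f b"
    by (rule finite_image_Max_Min_obtain[OF finite_nbrs, of x f]) auto
  then have "0 \<le> f a \<and> f a \<le> 1" "0 \<le> f b \<and> f b \<le> 1"
    using Suc.IH nbrs_subset by (auto simp: f_def)
  then show ?case
    using Suc.IH[OF Suc.prems] mm by (simp add: Let_def f_def[symmetric] x_def[symmetric])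
qed

end

section \<open>Spiders\<close>

text \<open>
  Vertex \<open>0\<close> is the centre and \<open>v\<close> is joined to \<open>v - m\<close>, which truncated subtraction makes the
  centre for \<open>v \<le> m\<close>.  The \<open>m\<close> legs are thus the residue classes modulo \<open>m\<close>.
\<close>

definition spider :: "nat \<Rightarrow> nat \<Rightarrow> nat pair_pre_digraph" where
  "spider m n = \<lparr>pverts = {..n},
     parcs = {(u, v). u \<le> n \<and> v \<le> n \<and> (v \<noteq> 0 \<and> u = v - m \<or> u \<noteq> 0 \<and> v = u - m)}\<rparr>"

lemma pverts_spider [simp]: "pverts (spider m n) = {..n}"
  by (simp add: spider_def)

lemma parcs_spider:
  "(u, v) \<in> parcs (spider m n) \<longleftrightarrow> u \<le> n \<and> v \<le> n \<and> (v \<noteq> 0 \<and> u = v - m \<or> u \<noteq> 0 \<and> v = u - m)"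
  by (simp add: spider_def)

text \<open>For \<open>m \<ge> 1\<close> this is the ceiling of \<open>v / m\<close>, the number of
  steps from \<open>v\<close> to \<open>v - m\<close> until the centre is reached.\<close>

definition depth :: "nat \<Rightarrow> nat \<Rightarrow> nat" where
  "depth m v = (v + m - 1) div m"

lemma depth_0: "m \<ge> 1 \<Longrightarrow> depth m 0 = 0"
  by (simp add: depth_def)

lemma depth_step:
  assumes "m \<ge> 1" "v \<ge> 1"
  shows "depth m v = Suc (depth m (v - m))"
proof -
  have "v + m - 1 = (v - 1) + m"
    using assms by simp
  then have "depth m v = Suc ((v - 1) div m)"
    unfolding depth_def using assms by (simp only: div_add_self2)
  moreover have "depth m (v - m) = (v - 1) div m"
    using assms by (cases "m \<le> v") (auto simp: depth_def)
  ultimately show ?thesis by simp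
qed

lemma pair_graph_spider:
  assumes "m \<ge> 1"
  shows "pair_graph (spider m n)"
proof -
  have "finite (parcs (spider m n))"
    by (rule finite_subset[of _ "{..n} \<times> {..n}"]) (auto simp: spider_def)
  then show ?thesis
    using assms by unfold_locales (auto simp: spider_def symmetric_def intro!: symI)
qed

lemma spider_awalk_centre:
  assumes m: "m \<ge> 1" and "v \<le> n"
  shows "\<exists>p. pre_digraph.awalk (with_proj (spider m n)) v p 0 \<and> length p = depth m v"
  using assms(2)
proof (induction v rule: less_induct)
  case (less v)
  interpret pair_graph "spider m n" using m by (rule pair_graph_spider)
  show ?case
  proof (cases "v = 0")
    case True
    then have "awalk v [] 0" by (simp add: awalk_Nil_iff)
    then show ?thesis using True depth_0[OF m] by (intro exI[of _ "[]"]) simp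
  next
    case False
    then have "v - m < v" "v - m \<le> n"
      using less.prems m by auto
    then obtain p where p: "awalk (v - m) p 0" "length p = depth m (v - m)"
      using less.IH by blast
    then have "awalk v ((v, v - m) # p) 0"
      using False less.prems by (simp add: awalk_Cons_iff parcs_spider)
    then show ?thesis
      using p False m depth_step[of m v] by (intro exI[of _ "(v, v - m) # p"]) simp
  qed
qed

lemma connected_pair_graph_spider:
  assumes m: "m \<ge> 1"
  shows "connected_pair_graph (spider m n)"
proof -
  interpret pair_graph "spider m n" using m by (rule pair_graph_spider)
  have "\<exists>p. awalk u p v" if uv: "u \<le> n" "v \<le> n" for u v
  proof -
    obtain p q where "awalk u p 0" "awalk v q 0"
      using spider_awalk_centre[OF m] uv by blast
    then have "awalk u (p @ rev_path q) v"
      by (intro awalk_appendI) auto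
    then show ?thesis by blast
  qed
  then have "u \<rightarrow>\<^sup>*\<^bsub>with_proj (spider m n)\<^esub> v" if "u \<le> n" "v \<le> n" for u v
    using that reachable_awalk by blast
  then have "Digraph_Component.connected (with_proj (spider m n))"
    using reachable_mk_symmetric_eq[OF sym_arcs]
    unfolding connected_def strongly_connected_def by simp
  then show ?thesis
    by unfold_locales
qed

lemma spider_dist_le:
  assumes m: "m \<ge> 1" and uv: "u \<le> n" "v \<le> n"
  shows "graph_dist (spider m n) u v \<le> depth m u + depth m v"
proof -
  interpret connected_pair_graph "spider m n" using m by (rule connected_pair_graph_spider)
  obtain p q where p: "awalk u p 0" "length p = depth m u" and q: "awalk v q 0" "length q = depth m v"
    using spider_awalk_centre[OF m] uv by blast
  then have "awalk u (p @ rev_path q) v"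
    by (intro awalk_appendI) auto
  moreover have "length (rev_path q) = length q" for q :: "(nat \<times> nat) list"
    by (induction q) auto
  ultimately show ?thesis
    using graph_dist_le[of u "p @ rev_path q" v] p q by simp
qed

text \<open>Walks through the centre give the upper bound. A signed depth, changing by at most 1
  along each arc, gives the lower bound. The offset \<open>e\<close> lengthens a single leg to
  realise odd diameters.\<close>

lemma graph_diam_spider:
  assumes m: "m \<ge> 2" "even m" and l: "l \<ge> 1" and e: "e \<le> 1"
  shows "graph_diam (spider m (m * l + e)) = 2 * l + e"
proof -
  define n where "n = m * l + e"
  have m1: "m \<ge> 1" using m by simp
  interpret connected_pair_graph "spider m n" using m1 by (rule connected_pair_graph_spider)
  have depth_le: "depth m v \<le> j" if "v \<le> m * j" for v j
  proof -
    have "v + m - 1 < m * Suc j" using that m by simp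
    then show ?thesis
      unfolding depth_def using m by (simp add: less_mult_imp_div_less mult.commute less_Suc_eq_le[symmetric] del: mult_Suc_right)
  qed
  \<comment> \<open>Of two distinct vertices the smaller is at most \<open>m * l\<close>: only the
    vertex \<open>m * l + 1\<close>, present when \<open>e = 1\<close>, has depth
    \<open>l + 1\<close>.\<close>
  have upper: "graph_dist (spider m n) u v \<le> 2 * l + e" if uv: "u \<le> n" "v \<le> n" "u < v" for u v
  proof -
    have "u \<le> m * l" using uv e by (simp add: n_def)
    then have "depth m u \<le> l" by (rule depth_le)
    moreover have "v \<le> m * (l + e)"
      using uv m e by (cases e) (auto simp: n_def)
    then have "depth m v \<le> l + e" by (rule depth_le)
    ultimately show ?thesis
      using spider_dist_le[OF m1 uv(1,2)] by simp
  qed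
  have upper': "graph_dist (spider m n) u v \<le> 2 * l + e" if uv: "u \<le> n" "v \<le> n" for u v
    using upper[of u v] upper[of v u] graph_dist_commute[of u v] graph_dist_self[of u] uv
    by (cases u v rule: linorder_cases) auto
  \<comment> \<open>As \<open>m\<close> is even, parity is constant along a leg, so the sign can
    only change at the centre, where the depth is 0.\<close>
  define g where "g v = (if odd v then int (depth m v) else - int (depth m v))" for v
  have edge: "\<bar>g v - g (v - m)\<bar> \<le> 1" if "v \<noteq> 0" for v
  proof (cases "m \<le> v")
    case True
    then have "odd (v - m) = odd v" using m by simp
    then show ?thesis
      using depth_step[of m v] m1 that by (simp add: g_def)
  next
    case False
    then show ?thesis
      using depth_step[of m v] depth_0[OF m1] m1 that by (simp add: g_def)
  qed
  have g: "\<bar>g x - g y\<bar> \<le> 1" if "(x, y) \<in> parcs (spider m n)" for x y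
    using that edge[of x] edge[of y] by (auto simp: parcs_spider abs_minus_commute)
  \<comment> \<open>The first vertex at depth \<open>l + e\<close>, on an odd leg; its partner
    \<open>y\<close> is the last vertex at depth \<open>l\<close>, on an even leg.\<close>
  define x where "x = m * (l + e - 1) + 1"
  have x: "x \<le> n" "odd x" "depth m x = l + e"
  proof -
    have "m * (l - 1) + 1 \<le> m * l"
      using m l by (cases l) auto
    then show "x \<le> n" using e by (cases e) (auto simp: x_def n_def)
    show "odd x" using m by (simp add: x_def)
    have "x + m - 1 = m * (l + e)" using l by (cases l) (auto simp: x_def algebra_simps)
    then show "depth m x = l + e" using m1 by (simp add: depth_def)
  qed
  define y where "y = m * l"
  have y: "y \<le> n" "even y" "depth m y = l"
  proof -
    show "y \<le> n" "even y" using m by (auto simp: y_def n_def)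
    have "y + m - 1 = (m - 1) + m * l" using m1 by (simp add: y_def)
    then have "depth m y = l + (m - 1) div m"
      using m1 unfolding depth_def by (simp only: div_mult_self2)
    then show "depth m y = l" using m1 by simp
  qed
  have "\<bar>g x - g y\<bar> \<le> int (graph_dist (spider m n) x y)"
    using potential_le_graph_dist[of g x y] g x y by simp
  then have "2 * l + e \<le> graph_dist (spider m n) x y"
    using x y by (simp add: g_def)
  then have "graph_diam (spider m n) = 2 * l + e"
    using upper' x y by (intro graph_diam_eqI[of "2 * l + e" x y]) auto
  then show ?thesis by (simp add: n_def)
qed

section \<open>Legs as averaging paths\<close>

definition leg :: "nat \<Rightarrow> nat \<Rightarrow> nat \<Rightarrow> nat" where
  "leg m c i = c + i * m - m"

text \<open>Inverse to \<open>leg\<close> at positions from 1 on. For \<open>c \<ge> 1\<close> the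
  value 0 marks the centre and all vertices off the leg, which \<open>path_step\<close>
  ignores.\<close>

definition leg_index :: "nat \<Rightarrow> nat \<Rightarrow> nat \<Rightarrow> nat" where
  "leg_index m c v = (if c \<le> v \<and> m dvd v - c then Suc ((v - c) div m) else 0)"

lemma leg_Suc: "leg m c (Suc i) = c + i * m"
  by (simp add: leg_def)

lemma leg_0: "c \<le> m \<Longrightarrow> leg m c 0 = 0"
  by (simp add: leg_def)

lemma leg_index_eq_iff:
  assumes "m \<ge> 1" "i \<ge> 1"
  shows "leg_index m c v = i \<longleftrightarrow> v = leg m c i"
proof -
  obtain j where j: "i = Suc j" using assms by (cases i) auto
  have "leg_index m c v = Suc j \<longleftrightarrow> v = c + j * m"
  proof
    assume "leg_index m c v = Suc j"
    then have "c \<le> v" "m dvd v - c" "(v - c) div m = j"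
      by (auto simp: leg_index_def split: if_splits)
    then have "v - c = j * m" by (metis dvd_div_mult_self)
    then show "v = c + j * m" using \<open>c \<le> v\<close> by simp
  next
    assume "v = c + j * m"
    then show "leg_index m c v = Suc j"
      using assms(1) by (simp add: leg_index_def)
  qed
  then show ?thesis by (simp add: j leg_Suc)
qed

lemma nbrs_spider_leg:
  assumes c: "1 \<le> c" "c \<le> m" and i: "1 \<le> i" "leg m c i \<le> n"
  shows "nbrs (spider m n) (leg m c i)
    = {leg m c (i - 1)} \<union> (if leg m c (i + 1) \<le> n then {leg m c (i + 1)} else {})"
proof -
  obtain j where j: "i = Suc j" using i by (cases i) auto
  define v where "v = leg m c i"
  have v: "v \<noteq> 0" "v \<le> n" using c i by (auto simp: v_def j leg_Suc)
  have down: "leg m c (i - 1) = v - m"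
    using c by (simp add: v_def j leg_Suc leg_def)
  have up: "leg m c (i + 1) = v + m"
    by (simp add: v_def j leg_Suc)
  have "nbrs (spider m n) v = {v - m} \<union> (if v + m \<le> n then {v + m} else {})"
    using v by (auto simp: nbrs_def parcs_spider)
  then show ?thesis
    unfolding down up v_def[symmetric] .
qed

definition leg_length :: "nat \<Rightarrow> nat \<Rightarrow> nat \<Rightarrow> nat" where
  "leg_length m n c = Suc ((n - c) div m)"

lemma leg_le_iff:
  assumes "m \<ge> 1" "c \<le> n" "i \<ge> 1"
  shows "leg m c i \<le> n \<longleftrightarrow> i \<le> leg_length m n c"
proof -
  obtain j where j: "i = Suc j" using assms by (cases i) auto
  have "j \<le> (n - c) div m \<longleftrightarrow> j * m \<le> n - c"
    using assms by (simp add: less_eq_div_iff_mult_less_eq)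
  then show ?thesis
    using assms by (auto simp: j leg_Suc leg_length_def)
qed

text \<open>A leg vertex has at most two neighbours, so its midrange is their ordinary average and
  the dynamics is linear there.\<close>

lemma spider_leg_update:
  fixes f0 :: "nat \<Rightarrow> real"
  assumes c: "1 \<le> c" "c \<le> m" "c \<le> n" and i: "1 \<le> i" "i \<le> leg_length m n c"
    and x: "vs (Suc t) = leg m c i"
  shows "lipschitz_dyn (spider m n) f0 vs (Suc t) (leg m c i)
    = (if i = leg_length m n c then lipschitz_dyn (spider m n) f0 vs t (leg m c (i - 1))
       else (lipschitz_dyn (spider m n) f0 vs t (leg m c (i - 1))
           + lipschitz_dyn (spider m n) f0 vs t (leg m c (i + 1))) / 2)"
proof -
  have "leg m c i \<le> n"
    using leg_le_iff[of m c n i] c i by simp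
  moreover have "leg m c (i + 1) \<le> n \<longleftrightarrow> i \<noteq> leg_length m n c"
    using leg_le_iff[of m c n "i + 1"] c i by auto
  ultimately show ?thesis
    using nbrs_spider_leg[of c m i n] c i x by (simp add: Let_def max_def min_def)
qed

text \<open>
  The sign \<open>\<sigma>\<close> treats legs starting at \<open>1\<close> and legs starting at \<open>0\<close> alike: on the latter the
  argument applies to \<open>1 - f\<close>.
\<close>

lemma spider_leg_updates:
  fixes f0 :: "nat \<Rightarrow> real"
  assumes m: "m \<ge> 2" and c: "1 \<le> c" "c \<le> m" "c \<le> n" "1 \<le> n"
    and f0: "\<And>v. v \<le> n \<Longrightarrow> 0 \<le> f0 v \<and> f0 v \<le> 1"
    and vs: "\<And>t. t \<ge> 1 \<Longrightarrow> vs t \<le> n"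
    and \<sigma>: "(\<sigma>, \<beta>) = (1, 0) \<or> (\<sigma>, \<beta>) = (- 1, 1)"
    and start: "\<And>i. 1 \<le> i \<Longrightarrow> i \<le> leg_length m n c \<Longrightarrow> \<beta> + \<sigma> * f0 (leg m c i) = 1"
    and low: "\<beta> + \<sigma> * lipschitz_dyn (spider m n) f0 vs t (leg m c (leg_length m n c)) \<le> 3/4"
  shows "real (leg_length m n c) ^ 3 / 4096 \<le> real (card {s \<in> {1..t}. leg_index m c (vs s) \<noteq> 0})"
proof -
  interpret connected_pair_graph "spider m n" using m by (intro connected_pair_graph_spider) simp
  define K where "K = leg_length m n c"
  define F where "F t i = \<beta> + \<sigma> * lipschitz_dyn (spider m n) f0 vs t (leg m c i)" for t i
  define p where "p s = leg_index m c (vs s)" for s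
  have K: "K \<ge> 1" by (simp add: K_def leg_length_def)
  have p: "p s = i \<longleftrightarrow> vs s = leg m c i" if "i \<ge> 1" for s i
    using leg_index_eq_iff[of m i c] m that by (simp add: p_def)
  have inj: "leg m c i \<noteq> leg m c j" if "1 \<le> i" "1 \<le> j" "i \<noteq> j" for i j
    using that m leg_index_eq_iff[of m i c "leg m c i"] leg_index_eq_iff[of m j c "leg m c i"] by auto
  have bnd: "0 \<le> lipschitz_dyn (spider m n) f0 vs t v \<and> lipschitz_dyn (spider m n) f0 vs t v \<le> 1"
    if "v \<le> n" for t v
    using lipschitz_dyn_bounds[of f0 vs v t] f0 vs that c by (auto simp: image_subset_iff)
  \<comment> \<open>Of the rest of the graph only \<open>0 \<le> F t 0\<close> at the centre is
    kept, which is all that comparison with a frozen end requires.\<close>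
  have "path_dyn K p t K \<le> F t K"
  proof (rule path_dyn_le)
    show "real i / real K \<le> F 0 i" if "i \<le> K" for i
    proof (cases "i = 0")
      case True
      then show ?thesis using \<sigma> f0[of 0] c by (auto simp: F_def leg_0)
    next
      case False
      then show ?thesis using start[of i] that by (simp add: F_def K_def)
    qed
    show "0 \<le> F t 0" for t
      using \<sigma> bnd[of 0 t] c by (auto simp: F_def leg_0)
    show "F (Suc t) i = (if i = K then F t (K - 1) else (F t (i - 1) + F t (i + 1)) / 2)"
      if i: "1 \<le> i" "i \<le> K" "p (Suc t) = i" for t i
    proof -
      have "vs (Suc t) = leg m c i" using p i by simp
      then have "lipschitz_dyn (spider m n) f0 vs (Suc t) (leg m c i)
          = (if i = K then lipschitz_dyn (spider m n) f0 vs t (leg m c (i - 1))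
             else (lipschitz_dyn (spider m n) f0 vs t (leg m c (i - 1))
                 + lipschitz_dyn (spider m n) f0 vs t (leg m c (i + 1))) / 2)"
        using c i unfolding K_def by (intro spider_leg_update) auto
      then show ?thesis
        unfolding F_def by (auto simp: field_simps simp del: lipschitz_dyn.simps)
    qed
    show "F (Suc t) i = F t i" if i: "1 \<le> i" "i \<le> K" "p (Suc t) \<noteq> i" for t i
      using p[of i "Suc t"] i by (simp add: F_def Let_def)
  qed simp
  then have "path_dyn K p t K \<le> 3/4"
    using low by (simp add: F_def K_def)
  then have "real K ^ 3 / 4096 \<le> real (card {s \<in> {1..t}. 1 \<le> p s \<and> p s \<le> K})"
    using path_dyn_lower_bound K by blast
  also have "\<dots> \<le> real (card {s \<in> {1..t}. leg_index m c (vs s) \<noteq> 0})"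
    unfolding of_nat_le_iff by (intro card_mono) (auto simp: p_def)
  finally show ?thesis by (simp add: K_def)
qed

text \<open>Two numbers in \<open>{1..m}\<close> congruent modulo \<open>m\<close> are equal.
  Updates on different legs can therefore be counted separately.\<close>

lemma disjoint_legs:
  assumes "1 \<le> c" "c \<le> m" "1 \<le> c'" "c' \<le> m" "leg_index m c v \<noteq> 0" "leg_index m c' v \<noteq> 0"
  shows "c = c'"
proof -
  have *: "b = a" if ab: "a \<le> b" "1 \<le> a" "b \<le> m" "b \<le> v" "m dvd v - a" "m dvd v - b" for a b
  proof -
    have "m dvd (v - a) - (v - b)" using ab by (metis dvd_diff_nat)
    moreover have "(v - a) - (v - b) = b - a" using ab by linarith
    ultimately have "m dvd b - a" by simp
    moreover have "b - a < m" using ab by simp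
    ultimately show ?thesis using ab by (auto dest: dvd_imp_le)
  qed
  have "c \<le> v" "m dvd v - c" "c' \<le> v" "m dvd v - c'"
    using assms by (auto simp: leg_index_def split: if_splits)
  then show ?thesis
    using *[of c c'] *[of c' c] assms by (cases "c \<le> c'") auto
qed

text \<open>If some odd tip were above \<open>3/4\<close> and some even tip below
  \<open>1/4\<close>, the oscillation would exceed \<open>1/2\<close>. So all \<open>k\<close> legs
  of one parity have relaxed, each at the cost of its own \<open>l^3 / 4096\<close> updates.\<close>

lemma spider_lower_bound:
  fixes vs :: "nat \<Rightarrow> nat"
  defines "init \<equiv> \<lambda>v. if odd v then 1 else (0::real)"
  assumes k: "k \<ge> 1" and l: "l \<ge> 1" and n: "n = 2 * k * l + e"
    and vs: "\<And>t. t \<ge> 1 \<Longrightarrow> vs t \<le> n"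
    and osc: "osc (spider (2 * k) n) (lipschitz_dyn (spider (2 * k) n) init vs t) \<le> 1/2"
  shows "real k * real l ^ 3 / 4096 \<le> real t"
proof -
  define m where "m = 2 * k"
  define f where "f = lipschitz_dyn (spider m n) init vs t"
  have m: "m \<ge> 2" using k by (simp add: m_def)
  have mn: "m \<le> n" using k l by (cases l) (auto simp: m_def n)
  have len: "l \<le> leg_length m n c" if "1 \<le> c" "c \<le> m" for c
  proof -
    have "leg m c l \<le> n"
      using that l by (cases l) (auto simp: leg_Suc n m_def)
    then show ?thesis
      using leg_le_iff[of m c n l] m l that mn by simp
  qed
  have parity: "odd (leg m c i) = odd c" if "i \<ge> 1" for c i
    using that by (cases i) (auto simp: leg_Suc m_def)
  define S where "S c = {s \<in> {1..t}. leg_index m c (vs s) \<noteq> 0}" for c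
  define C where "C b = (\<lambda>j. 2 * j + (if b then 1 else 2)) ` {..<k}" for b :: bool
  have C: "1 \<le> c \<and> c \<le> m \<and> odd c = b" if "c \<in> C b" for c b
    using that by (auto simp: C_def m_def split: if_splits)
  have low: "\<exists>b. \<forall>c\<in>C b. (if b then 0 else 1) + (if b then 1 else - 1) * f (leg m c (leg_length m n c)) \<le> 3/4"
  proof (rule ccontr)
    assume "\<not> ?thesis"
    then have ex: "\<exists>c\<in>C b. \<not> (if b then 0 else 1)
        + (if b then 1 else - 1) * f (leg m c (leg_length m n c)) \<le> 3/4" for b
      by blast
    obtain c where c: "c \<in> C True" "f (leg m c (leg_length m n c)) > 3/4"
      using ex[of True] by (auto simp: not_le)
    obtain c' where c': "c' \<in> C False" "1 - f (leg m c' (leg_length m n c')) > 3/4"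
      using ex[of False] by (auto simp: not_le)
    have tip: "leg m c (leg_length m n c) \<le> n" if "c \<in> C b" for c b
      using leg_le_iff[of m c n "leg_length m n c"] C[OF that] m mn by (simp add: leg_length_def)
    have "f (leg m c (leg_length m n c)) \<le> Max (f ` {..n})" "Min (f ` {..n}) \<le> f (leg m c' (leg_length m n c'))"
      using tip c c' by auto
    then show False
      using osc c c' by (simp add: osc_def f_def m_def)
  qed
  then obtain b where b: "\<And>c. c \<in> C b \<Longrightarrow>
    (if b then 0 else 1) + (if b then 1 else - 1) * f (leg m c (leg_length m n c)) \<le> 3/4"
    by blast
  have "real l ^ 3 / 4096 \<le> real (card (S c))" if c: "c \<in> C b" for c
  proof -
    have "real l ^ 3 / 4096 \<le> real (leg_length m n c) ^ 3 / 4096"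
      using len C[OF c] by (intro divide_right_mono power_mono) auto
    also have "\<dots> \<le> real (card (S c))"
      unfolding S_def
    proof (rule spider_leg_updates[where ?f0.0 = init and \<sigma> = "if b then 1 else - 1" and \<beta> = "if b then 0 else 1"])
      show "(if b then 0 else 1) + (if b then 1 else - 1) * init (leg m c i) = 1"
        if "1 \<le> i" for i
        using parity[OF that, of c] C[OF c] by (auto simp: init_def)
    qed (use m C[OF c] mn vs b[OF c] in \<open>auto simp: init_def f_def\<close>)
    finally show ?thesis .
  qed
  then have "(\<Sum>c\<in>C b. real l ^ 3 / 4096) \<le> real (\<Sum>c\<in>C b. card (S c))"
    unfolding of_nat_sum by (intro sum_mono)
  also have "(\<Sum>c\<in>C b. card (S c)) = card (\<Union>c\<in>C b. S c)"
  proof (rule card_UN_disjoint[symmetric])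
    have "c = c'" if "c \<in> C b" "c' \<in> C b" "s \<in> S c" "s \<in> S c'" for c c' s
      using C[OF that(1)] C[OF that(2)] that(3,4) disjoint_legs[of c m c' "vs s"] by (simp add: S_def)
    then show "\<forall>c\<in>C b. \<forall>c'\<in>C b. c \<noteq> c' \<longrightarrow> S c \<inter> S c' = {}"
      by blast
  qed (auto simp: C_def S_def)
  also have "\<dots> \<le> card {1..t}"
    by (intro card_mono) (auto simp: S_def)
  also have "card (C b) = k"
    by (simp add: C_def card_image inj_on_def)
  then have "(\<Sum>c\<in>C b. real l ^ 3 / 4096) = real k * real l ^ 3 / 4096"
    by simp
  finally show ?thesis by simp
qed

section \<open>From updates to consensus time, and the choice of the spider\<close>

lemma le_consensus_time:
  assumes "\<And>t. osc G (lipschitz_dyn G f0 vs t) \<le> \<epsilon> \<Longrightarrow> x \<le> real t"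
  shows "ennreal x \<le> ennreal_of_enat (consensus_time G f0 vs \<epsilon>)"
proof -
  \<comment> \<open>Runs that never reach the threshold are covered, since the infimum of the empty
    set is infinite.\<close>
  have "enat (nat \<lceil>x\<rceil>) \<le> consensus_time G f0 vs \<epsilon>"
    unfolding consensus_time_def using assms by (intro Inf_greatest) fastforce
  then have "ennreal_of_enat (enat (nat \<lceil>x\<rceil>)) \<le> ennreal_of_enat (consensus_time G f0 vs \<epsilon>)"
    by (simp only: ennreal_of_enat_le_iff)
  moreover have "ennreal x \<le> ennreal (real (nat \<lceil>x\<rceil>))"
    by (intro ennreal_leI) linarith
  moreover have "ennreal (real (nat \<lceil>x\<rceil>)) = ennreal_of_enat (enat (nat \<lceil>x\<rceil>))"
    by (simp add: ennreal_of_nat_eq_real_of_nat)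
  ultimately show ?thesis
    by (metis order_trans)
qed

lemma exists_slow_graph:
  fixes N L :: nat
  assumes NL: "N > L" "L \<ge> 2"
  shows "\<exists>(G :: nat pair_pre_digraph) (f0 :: nat \<Rightarrow> real).
    pair_graph G \<and> Digraph_Component.connected (with_proj G) \<and>
    card (pverts G) \<le> N \<and> graph_diam G = L \<and> f0 ` pverts G \<subseteq> {0..1} \<and>
    (\<forall>vs :: nat \<Rightarrow> nat. (\<forall>t\<ge>1. vs t \<in> pverts G) \<longrightarrow>
      ennreal (1 / 294912 * real N * (real (graph_diam G))^2)
        \<le> ennreal_of_enat (consensus_time G f0 vs (1/2)))"
proof -
  define e where "e = L mod 2"
  define l where "l = L div 2"
  \<comment> \<open>The largest \<open>k\<close> for which the centre, \<open>2 * k\<close> legs of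
    length \<open>l\<close> and \<open>e\<close> extra vertices fit into \<open>N\<close>
    vertices.\<close>
  define k where "k = (N - 1 - e) div (2 * l)"
  define n where "n = 2 * k * l + e"
  define f0 where "f0 = (\<lambda>v::nat. if odd v then 1 else (0::real))"
  have L: "L = 2 * l + e" "e \<le> 1" by (auto simp: e_def l_def)
  have l: "l \<ge> 1" using NL by (simp add: l_def)
  have "2 * l \<le> N - 1 - e" using NL L by simp
  then have k: "k \<ge> 1"
    using l by (simp add: k_def div_greater_zero_iff Suc_le_eq)
  have "2 * k * l \<le> N - 1 - e"
    unfolding k_def using div_times_less_eq_dividend[of "N - 1 - e" "2 * l"] by (simp add: mult_ac)
  then have n: "n + 1 \<le> N" using NL L by (simp add: n_def)
  interpret connected_pair_graph "spider (2 * k) n"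
    using k by (intro connected_pair_graph_spider) simp
  have diam: "graph_diam (spider (2 * k) n) = L"
    unfolding n_def L(1) using k l L(2) by (intro graph_diam_spider) auto
  \<comment> \<open>Rounding down in \<open>k\<close> loses at most a factor 2, and so does removing
    \<open>1 + e\<close> vertices from \<open>N\<close>.\<close>
  have N: "N \<le> 8 * l * k"
  proof -
    have "N - 1 - e < 2 * l + 2 * l * k"
      unfolding k_def using l by (intro dividend_less_times_div) simp
    moreover have "l \<le> l * k" using k by simp
    ultimately have "N - 1 - e < 4 * (l * k)"
      unfolding mult.assoc by linarith
    moreover have "N \<le> 2 * (N - 1 - e)"
      using NL L l by linarith
    ultimately show ?thesis
      by (simp add: mult.assoc)
  qed
  have bound: "1 / 294912 * real N * (real L)^2 \<le> real k * real l ^ 3 / 4096"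
  proof -
    \<comment> \<open>With \<open>L \<le> 3 * l\<close> the constant is
      \<open>8 * 9 * 4096 = 294912\<close>.\<close>
    have "real N * (real L)^2 \<le> real (8 * l * k) * (real (3 * l))^2"
      using N L l by (intro mult_mono power_mono) (auto simp: of_nat_le_iff simp del: of_nat_mult)
    then show ?thesis
      by (simp add: power2_eq_square power3_eq_cube algebra_simps)
  qed
  have "ennreal (1 / 294912 * real N * (real L)^2)
      \<le> ennreal_of_enat (consensus_time (spider (2 * k) n) f0 vs (1/2))"
    if vs: "\<And>t. t \<ge> 1 \<Longrightarrow> vs t \<in> pverts (spider (2 * k) n)" for vs
  proof (rule le_consensus_time)
    fix t assume "osc (spider (2 * k) n) (lipschitz_dyn (spider (2 * k) n) f0 vs t) \<le> 1/2"
    then have "real k * real l ^ 3 / 4096 \<le> real t"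
      unfolding f0_def using vs k l n_def by (intro spider_lower_bound[of k l n e vs t]) auto
    then show "1 / 294912 * real N * (real L)^2 \<le> real t"
      using bound by linarith
  qed
  then show ?thesis
    using pair_graph connected n diam
    by (intro exI[of _ "spider (2 * k) n"] exI[of _ f0]) (auto simp: f0_def)
qed

theorem theorem1p3:
  shows
   "(\<forall>(G :: 'a pair_pre_digraph) (f0 :: 'a \<Rightarrow> real) (P :: 'w measure) (X :: nat \<Rightarrow> 'w \<Rightarrow> 'a)
       (n :: nat) (\<epsilon> :: real).
       pair_graph G \<and> Digraph_Component.connected (with_proj G) \<and>
       card (pverts G) = n \<and> n \<ge> 2 \<and>
       f0 ` pverts G \<subseteq> {0..1} \<and>
       prob_space P \<and> iid_uniform P (pverts G) X \<and>
       0 < \<epsilon> \<and> \<epsilon> < 1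
       \<longrightarrow>
       (\<integral>\<^sup>+ \<omega>. ennreal_of_enat (consensus_time G f0 (\<lambda>t. X t \<omega>) \<epsilon>) \<partial>P)
         \<le> ennreal (real n * (ln (real n) + 1) * (real (graph_diam G) + 1)^2 * ln (2 / \<epsilon>)))
    \<and>
    (\<exists>c::real. c > 0 \<and>
       (\<forall>N L :: nat. N > L \<and> L \<ge> 2 \<longrightarrow>
          (\<exists>(G :: nat pair_pre_digraph) (f0 :: nat \<Rightarrow> real).
             pair_graph G \<and> Digraph_Component.connected (with_proj G) \<and>
             card (pverts G) \<le> N \<and> graph_diam G = L \<and>
             f0 ` pverts G \<subseteq> {0..1} \<and>
             (\<forall>vs :: nat \<Rightarrow> nat. (\<forall>t\<ge>1. vs t \<in> pverts G) \<longrightarrow>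
                ennreal (c * real N * (real (graph_diam G))^2)
                  \<le> ennreal_of_enat (consensus_time G f0 vs (1/2))))))"
proof (intro conjI allI impI, goal_cases)
  case (1 G f0 P X n \<epsilon>)
  then interpret connected_pair_graph G
    by (simp add: connected_pair_graph_def connected_pair_graph_axioms_def)
  show ?case
    using expected_consensus_time[of f0 P X \<epsilon>] 1 by simp
next
  case 2
  show ?case
    using exists_slow_graph by (intro exI[of _ "1 / 294912"]) simp
qed

end
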